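(* (1) Let $\Psi\subseteq\Sigma^\times$ be a set of equations. For every predicate $A\in\Pi^+$ the following are equivalent: (a) $A\in\mathsf{CT}_\omega^\Psi$; (b) $\Psi\vdash^+1'\le A$; (c) whenever $h\colon\mathfrak P\to\mathfrak A$ is a homomorphism and $\mathfrak A\in\mathsf{RRA}$, then $\mathfrak A\models_h\Psi$ implies $\mathfrak A\models_h1'\le A$; (d) the sequent $\;|\;v_0Av_0$ is $\omega$-provable from the sequents corresponding to $\Psi$; (e) $\{\mathsf G(\varepsilon):\varepsilon\in\Psi\}\vdash\forall v_0\,\mathsf G(v_0Av_0)$. (2) For every $A\in\Pi^+$ the following are equivalent: (a) $A\in\mathsf{CT}_\omega$; (b) $\vdash^+1'\le A$; (c) $1'\le A$ is true in every representable relation algebra; (d) $\;|\;v_0Av_0$ is $\omega$-provable; (e) $\vdash\forall v_0\,\mathsf G(v_0Av_0)$.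
   Context: **Predicates and equations.** $\Pi$ is a countably infinite set of binary relation symbols containing the equality symbol $1'$; members of $\Pi$ other than $1'$ are propositional variables. $\Pi^+$ (predicates) is the absolutely free closure of $\Pi$ under the formal operators $A+B$, $\overline A$, $A;B$, $A^\smile$. An equation is a formal expression $A\doteq B$ with $A,B\in\Pi^+$; $\Sigma^\times$ is the set of equations; $A\le B$ denotes $A+B\doteq B$. $\mathfrak P=(\Pi^+,+,\overline{\phantom a},;,{}^\smile,1')$ is the predicate algebra. **Algebras.** For a homomorphism $h\colon\mathfrak P\to\mathfrak A$ and a set $\Psi$ of equations, $\mathfrak A\models_h\Psi$ means $h(A)=h(B)$ for all $A\doteq B$ in $\Psi$ (for a single equation, take the singleton). An equation is true in $\mathfrak A$ if it holds under every homomorphism $h$. A proper relation algebra is an algebra $(U,+,\overline{\phantom a},;,{}^\smile,1')$ for which there is an equivalence relation $E\in U$ such that $U$ is a set of binary relations included in $E$, $+$ is union, $\overline X=E\setminus X$, $;$ is relational composition $X;Y=\{(x,y):\exists z\,(x,z)\in X,(z,y)\in Y\}$, $X^\smile=\{(x,y):(y,x)\in X\}$, and $1'=\{(x,x):(x,x)\in E\}$. $\mathsf{RRA}$ (representable relation algebras) is the class of algebras isomorphic to proper relation algebras. **First-order formalisms.** Variables are $v_0,v_1,\dots$. Formulas of $\mathcal L^+$ are built from atomic formulas $xAy$ ($A\in\Pi^+$) and equations (no free variables) by $\Rightarrow,\neg,\forall x$ ($\lor,\land,\Leftrightarrow,\exists$ the usual abbreviations); formulas of $\mathcal L$ are those built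 from $xAy$ with $A\in\Pi$ only. $[\varphi]$ is the universal closure. Logical axioms, for $\varphi,\psi,\xi$ formulas of the formalism and variables $x,y$: $[(\varphi\Rightarrow\psi)\Rightarrow((\psi\Rightarrow\xi)\Rightarrow(\varphi\Rightarrow\xi))]$; $[(\neg\varphi\Rightarrow\varphi)\Rightarrow\varphi]$; $[\varphi\Rightarrow(\neg\varphi\Rightarrow\psi)]$; $[\forall x\forall y\varphi\Rightarrow\forall y\forall x\varphi]$; $[\forall x(\varphi\Rightarrow\psi)\Rightarrow(\forall x\varphi\Rightarrow\forall x\psi)]$; $[\forall x\varphi\Rightarrow\varphi]$; $[\varphi\Rightarrow\forall x\varphi]$ if $x$ is not free in $\varphi$; $[\exists x(x1'y)]$ if $x\ne y$; $[x1'y\Rightarrow(\varphi\Rightarrow\psi)]$ if $\varphi$ is atomic, $x$ occurs in $\varphi$, and $\psi$ is obtained from $\varphi$ by replacing one occurrence of $x$ by $y$. $\vdash$ is provability in $\mathcal L$ by modus ponens from these axioms; $\vdash^+$ is provability in $\mathcal L^+$ by modus ponens from these axioms and, for $A,B\in\Pi^+$: $[v_0(A+B)v_1\Leftrightarrow v_0Av_1\lor v_0Bv_1]$; $[v_0\overline Av_1\Leftrightarrow\neg v_0Av_1]$; $[v_0(A;B)v_1\Leftrightarrow\exists v_2(v_0Av_2\land v_2Bv_1)]$; $[v_0A^\smile v_1\Leftrightarrow v_1Av_0]$; $A\doteq B\Leftrightarrow[v_0Av_1\Leftrightarrow v_0Bv_1]$. **Translation** $\mathsf G$ from $\mathcal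 L^+$ to $\mathcal L$: $\mathsf G(xAy)=xAy$ if $A\in\Pi$; $\mathsf G$ commutes with $\Rightarrow,\neg,\forall x$; $\mathsf G(x(A+B)y)=\mathsf G(xAy)\lor\mathsf G(xBy)$; $\mathsf G(x\overline Ay)=\neg\mathsf G(xAy)$; $\mathsf G(x(A;B)y)=\exists z(\mathsf G(xAz)\land\mathsf G(zBy))$ with $z$ the first variable distinct from $x$ and $y$; $\mathsf G(xA^\smile y)=\mathsf G(yAx)$; $\mathsf G(A\doteq B)=[\mathsf G(v_0Av_1)\Leftrightarrow\mathsf G(v_0Bv_1)]$. **Sequent calculus.** An $\omega$-sequent $\Gamma\,|\,\Delta$ is a pair of subsets of $\{xAy:x,y\in\{v_0,v_1,\dots\},A\in\Pi^+\}$. It is an axiom if $\Gamma\cap\Delta\ne\emptyset$ or $x1'x\in\Delta$ for some $x$. Rules (premises $\leadsto$ conclusion): Cut: $\Gamma|\Delta,xAy$ and $xAy,\Gamma'|\Delta'\leadsto\Gamma,\Gamma'|\Delta,\Delta'$. Equality: $xAy,\Gamma|\Delta\leadsto xAz,z1'y,\Gamma|\Delta$. Sum: $xAy,\Gamma|\Delta$ and $xBy,\Gamma'|\Delta'\leadsto x(A+B)y,\Gamma,\Gamma'|\Delta,\Delta'$; $\Gamma|\Delta,xAy,xBy\leadsto\Gamma|\Delta,x(A+B)y$. Complement: $\Gamma|\Delta,xAy\leadsto x\overline Ay,\Gamma|\Delta$; $xAy,\Gamma|\Delta\leadsto\Gamma|\Delta,x\overline Ay$. Relative product: $xAy,yBz,\Gamma|\Delta\leadsto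 x(A;B)z,\Gamma|\Delta$ provided $y\ne x,z$ and $y$ occurs in no formula of $\Gamma\cup\Delta$; $\Gamma|\Delta,xAy$ and $\Gamma'|\Delta',yBz\leadsto\Gamma,\Gamma'|\Delta,\Delta',x(A;B)z$. Converse: $xAy,\Gamma|\Delta\leadsto yA^\smile x,\Gamma|\Delta$; $\Gamma|\Delta,xAy\leadsto\Gamma|\Delta,yA^\smile x$. A sequent is $\omega$-provable from a set $\Theta$ of sequents if it lies in every set of $\omega$-sequents containing $\Theta$ and the axioms and closed under the rules ($\omega$-provable if $\Theta=\emptyset$). The sequents corresponding to a set $\Psi$ of equations are all $v_iAv_j,\Gamma|v_iBv_j,\Delta$ and $v_iBv_j,\Gamma|v_iAv_j,\Delta$ with $i,j<\omega$ and $A\doteq B$ in $\Psi$. **Logics.** $\mathsf{CT}_\omega^\Psi=\{A\in\Pi^+:\Psi\vdash^+1'\le A\}$, $\mathsf{CT}_\omega=\mathsf{CT}_\omega^\emptyset$. *)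

theory Defs
  imports "HOL-Library.Countable_Set"
begin

section \<open>Predicates and equations\<close>

text \<open>The elements of \<open>'p\<close> are the propositional variables, so the set of relation symbols is
  \<open>\<Pi> = {1'} \<union> 'p\<close>.  It is countably infinite iff the type \<open>'p\<close> is; the theorem assumes this.\<close>

datatype 'p predicate =
    PVar 'p
  | PId
  | PPlus "'p predicate" "'p predicate"
  | PCompl "'p predicate"
  | PComp "'p predicate" "'p predicate"
  | PConv "'p predicate"

definition relation_symbols :: "'p predicate set" where
  "relation_symbols = insert PId (range PVar)"

datatype 'p equation = Eqn "'p predicate" "'p predicate"  (infix \<open>\<doteq>\<close> 52)

definition pred_le :: "'p predicate \<Rightarrow> 'p predicate \<Rightarrow> 'p equation" where
  "pred_le A B = (PPlus A B \<doteq> B)"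


section \<open>Algebras\<close>

record 'a rel_alg =
  carr :: "'a set"
  aplus :: "'a \<Rightarrow> 'a \<Rightarrow> 'a"
  acompl :: "'a \<Rightarrow> 'a"
  acomp :: "'a \<Rightarrow> 'a \<Rightarrow> 'a"
  aconv :: "'a \<Rightarrow> 'a"
  aid :: "'a"

definition is_algebra :: "'a rel_alg \<Rightarrow> bool" where
  "is_algebra \<AA> \<longleftrightarrow>
     (\<forall>a\<in>carr \<AA>. \<forall>b\<in>carr \<AA>. aplus \<AA> a b \<in> carr \<AA>) \<and>
     (\<forall>a\<in>carr \<AA>. acompl \<AA> a \<in> carr \<AA>) \<and>
     (\<forall>a\<in>carr \<AA>. \<forall>b\<in>carr \<AA>. acomp \<AA> a b \<in> carr \<AA>) \<and>
     (\<forall>a\<in>carr \<AA>. aconv \<AA> a \<in> carr \<AA>) \<and>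
     aid \<AA> \<in> carr \<AA>"

definition alg_hom :: "'a rel_alg \<Rightarrow> 'b rel_alg \<Rightarrow> ('a \<Rightarrow> 'b) \<Rightarrow> bool" where
  "alg_hom \<AA> \<BB> h \<longleftrightarrow>
     (\<forall>a\<in>carr \<AA>. h a \<in> carr \<BB>) \<and>
     (\<forall>a\<in>carr \<AA>. \<forall>b\<in>carr \<AA>. h (aplus \<AA> a b) = aplus \<BB> (h a) (h b)) \<and>
     (\<forall>a\<in>carr \<AA>. h (acompl \<AA> a) = acompl \<BB> (h a)) \<and>
     (\<forall>a\<in>carr \<AA>. \<forall>b\<in>carr \<AA>. h (acomp \<AA> a b) = acomp \<BB> (h a) (h b)) \<and>
     (\<forall>a\<in>carr \<AA>. h (aconv \<AA> a) = aconv \<BB> (h a)) \<and>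
     h (aid \<AA>) = aid \<BB>"

definition alg_iso :: "'a rel_alg \<Rightarrow> 'b rel_alg \<Rightarrow> bool" where
  "alg_iso \<AA> \<BB> \<longleftrightarrow> (\<exists>f. alg_hom \<AA> \<BB> f \<and> bij_betw f (carr \<AA>) (carr \<BB>))"

definition predicate_algebra :: "'p predicate rel_alg" where
  "predicate_algebra =
     \<lparr>carr = UNIV, aplus = PPlus, acompl = PCompl, acomp = PComp, aconv = PConv, aid = PId\<rparr>"

definition models_under ::
    "'a rel_alg \<Rightarrow> ('p predicate \<Rightarrow> 'a) \<Rightarrow> 'p equation set \<Rightarrow> bool" where
  "models_under \<AA> h \<Psi> \<longleftrightarrow>
     alg_hom predicate_algebra \<AA> h \<and> (\<forall>A B. (A \<doteq> B) \<in> \<Psi> \<longrightarrow> h A = h B)"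

definition true_in :: "'a rel_alg \<Rightarrow> 'p equation \<Rightarrow> bool" where
  "true_in \<AA> e \<longleftrightarrow> (\<forall>h. alg_hom predicate_algebra \<AA> h \<longrightarrow> models_under \<AA> h {e})"

text \<open>The field of \<open>E\<close>, hence the algebra, is not required to be the whole base type.\<close>

definition proper_rel_alg :: "('u \<times> 'u) set rel_alg \<Rightarrow> bool" where
  "proper_rel_alg \<AA> \<longleftrightarrow> is_algebra \<AA> \<and>
     (\<exists>E\<in>carr \<AA>. equiv (Field E) E \<and>
        (\<forall>X\<in>carr \<AA>. X \<subseteq> E) \<and>
        (\<forall>X\<in>carr \<AA>. \<forall>Y\<in>carr \<AA>. aplus \<AA> X Y = X \<union> Y) \<and>
        (\<forall>X\<in>carr \<AA>. acompl \<AA> X = E - X) \<and>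
        (\<forall>X\<in>carr \<AA>. \<forall>Y\<in>carr \<AA>.
           acomp \<AA> X Y = {(x, y). \<exists>z. (x, z) \<in> X \<and> (z, y) \<in> Y}) \<and>
        (\<forall>X\<in>carr \<AA>. aconv \<AA> X = {(x, y). (y, x) \<in> X}) \<and>
        aid \<AA> = {(x, x) | x. (x, x) \<in> E})"

text \<open>HOL cannot quantify over types inside a formula, so the type \<open>'u\<close> from which the bases
  of the representations are taken is a parameter, and so is the type \<open>'a\<close> of which the carrier
  is a subset.  The theorem is stated for all infinite \<open>'a\<close> and \<open>'u\<close>.  Finite types are covered
  by this, because they embed into infinite ones; they are excluded because over a small type
  there are too few algebras for completeness.\<close>

definition RRA :: "'u itself \<Rightarrow> 'a rel_alg set" where
  "RRA _ = {\<AA>. is_algebra \<AA> \<and>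
     (\<exists>\<BB> :: ('u \<times> 'u) set rel_alg. proper_rel_alg \<BB> \<and> alg_iso \<AA> \<BB>)}"


section \<open>First-order formalisms\<close>

text \<open>The variable \<open>v\<^sub>i\<close> is represented by its index \<open>i\<close>; \<open>At x A y\<close> is the expression \<open>xAy\<close>.\<close>

datatype 'p atom = At nat "'p predicate" nat

datatype 'p form =
    FAtom "'p atom"
  | FEqn "'p equation"
  | FImp "'p form" "'p form"  (infixr \<open>\<^bold>\<Rightarrow>\<close> 45)
  | FNot "'p form"
  | FAll nat "'p form"

abbreviation FRel :: "nat \<Rightarrow> 'p predicate \<Rightarrow> nat \<Rightarrow> 'p form" where
  "FRel x A y \<equiv> FAtom (At x A y)"

definition FOr :: "'p form \<Rightarrow> 'p form \<Rightarrow> 'p form"  (infixr \<open>\<^bold>\<or>\<close> 50) where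
  "\<phi> \<^bold>\<or> \<psi> = (FNot \<phi> \<^bold>\<Rightarrow> \<psi>)"

definition FAnd :: "'p form \<Rightarrow> 'p form \<Rightarrow> 'p form"  (infixr \<open>\<^bold>\<and>\<close> 55) where
  "\<phi> \<^bold>\<and> \<psi> = FNot (\<phi> \<^bold>\<Rightarrow> FNot \<psi>)"

definition FIff :: "'p form \<Rightarrow> 'p form \<Rightarrow> 'p form"  (infixr \<open>\<^bold>\<longleftrightarrow>\<close> 40) where
  "(\<phi> \<^bold>\<longleftrightarrow> \<psi>) = ((\<phi> \<^bold>\<Rightarrow> \<psi>) \<^bold>\<and> (\<psi> \<^bold>\<Rightarrow> \<phi>))"

definition FEx :: "nat \<Rightarrow> 'p form \<Rightarrow> 'p form" where
  "FEx x \<phi> = FNot (FAll x (FNot \<phi>))"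

fun atom_vars :: "'p atom \<Rightarrow> nat set" where
  "atom_vars (At x A y) = {x, y}"

primrec fvars :: "'p form \<Rightarrow> nat set" where
  "fvars (FAtom a) = atom_vars a"
| "fvars (FEqn e) = {}"
| "fvars (\<phi> \<^bold>\<Rightarrow> \<psi>) = fvars \<phi> \<union> fvars \<psi>"
| "fvars (FNot \<phi>) = fvars \<phi>"
| "fvars (FAll x \<phi>) = fvars \<phi> - {x}"

text \<open>The universal closure quantifies exactly the free variables, the one of least index
  outermost.\<close>

definition univ_closure :: "'p form \<Rightarrow> 'p form" where
  "univ_closure \<phi> = foldr FAll (sorted_list_of_set (fvars \<phi>)) \<phi>"

definition formulas_Lplus :: "'p form set" where
  "formulas_Lplus = UNIV"

inductive_set formulas_L :: "'p form set" where
  "A \<in> relation_symbols \<Longrightarrow> FRel x A y \<in> formulas_L"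
| "\<phi> \<in> formulas_L \<Longrightarrow> \<psi> \<in> formulas_L \<Longrightarrow> (\<phi> \<^bold>\<Rightarrow> \<psi>) \<in> formulas_L"
| "\<phi> \<in> formulas_L \<Longrightarrow> FNot \<phi> \<in> formulas_L"
| "\<phi> \<in> formulas_L \<Longrightarrow> FAll x \<phi> \<in> formulas_L"

text \<open>\<open>replace_one x y a b\<close>: \<open>b\<close> arises from \<open>a\<close> by replacing one occurrence of \<open>x\<close> by \<open>y\<close>.\<close>

inductive replace_one :: "nat \<Rightarrow> nat \<Rightarrow> 'p atom \<Rightarrow> 'p atom \<Rightarrow> bool" for x y where
  "replace_one x y (At x A z) (At y A z)"
| "replace_one x y (At z A x) (At z A y)"

text \<open>The parameter \<open>F\<close> is the set of formulas of the formalism.  In the last axiom an equation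
  need not be considered as the atomic formula, since no variable occurs in it.\<close>

inductive_set logical_axioms :: "'p form set \<Rightarrow> 'p form set" for F where
  "\<phi> \<in> F \<Longrightarrow> \<psi> \<in> F \<Longrightarrow> \<xi> \<in> F \<Longrightarrow>
     univ_closure ((\<phi> \<^bold>\<Rightarrow> \<psi>) \<^bold>\<Rightarrow> ((\<psi> \<^bold>\<Rightarrow> \<xi>) \<^bold>\<Rightarrow> (\<phi> \<^bold>\<Rightarrow> \<xi>))) \<in> logical_axioms F"
| "\<phi> \<in> F \<Longrightarrow> univ_closure ((FNot \<phi> \<^bold>\<Rightarrow> \<phi>) \<^bold>\<Rightarrow> \<phi>) \<in> logical_axioms F"
| "\<phi> \<in> F \<Longrightarrow> \<psi> \<in> F \<Longrightarrow> univ_closure (\<phi> \<^bold>\<Rightarrow> (FNot \<phi> \<^bold>\<Rightarrow> \<psi>)) \<in> logical_axioms F"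
| "\<phi> \<in> F \<Longrightarrow>
     univ_closure (FAll x (FAll y \<phi>) \<^bold>\<Rightarrow> FAll y (FAll x \<phi>)) \<in> logical_axioms F"
| "\<phi> \<in> F \<Longrightarrow> \<psi> \<in> F \<Longrightarrow>
     univ_closure (FAll x (\<phi> \<^bold>\<Rightarrow> \<psi>) \<^bold>\<Rightarrow> (FAll x \<phi> \<^bold>\<Rightarrow> FAll x \<psi>)) \<in> logical_axioms F"
| "\<phi> \<in> F \<Longrightarrow> univ_closure (FAll x \<phi> \<^bold>\<Rightarrow> \<phi>) \<in> logical_axioms F"
| "\<phi> \<in> F \<Longrightarrow> x \<notin> fvars \<phi> \<Longrightarrow> univ_closure (\<phi> \<^bold>\<Rightarrow> FAll x \<phi>) \<in> logical_axioms F"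
| "x \<noteq> y \<Longrightarrow> univ_closure (FEx x (FRel x PId y)) \<in> logical_axioms F"
| "FAtom a \<in> F \<Longrightarrow> replace_one x y a b \<Longrightarrow>
     univ_closure (FRel x PId y \<^bold>\<Rightarrow> (FAtom a \<^bold>\<Rightarrow> FAtom b)) \<in> logical_axioms F"

inductive_set definitional_axioms :: "'p form set" where
  "univ_closure (FRel 0 (PPlus A B) 1 \<^bold>\<longleftrightarrow> FRel 0 A 1 \<^bold>\<or> FRel 0 B 1) \<in> definitional_axioms"
| "univ_closure (FRel 0 (PCompl A) 1 \<^bold>\<longleftrightarrow> FNot (FRel 0 A 1)) \<in> definitional_axioms"
| "univ_closure (FRel 0 (PComp A B) 1 \<^bold>\<longleftrightarrow> FEx 2 (FRel 0 A 2 \<^bold>\<and> FRel 2 B 1))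
     \<in> definitional_axioms"
| "univ_closure (FRel 0 (PConv A) 1 \<^bold>\<longleftrightarrow> FRel 1 A 0) \<in> definitional_axioms"
| "(FEqn (A \<doteq> B) \<^bold>\<longleftrightarrow> univ_closure (FRel 0 A 1 \<^bold>\<longleftrightarrow> FRel 0 B 1)) \<in> definitional_axioms"

inductive mp_derivable :: "'p form set \<Rightarrow> 'p form \<Rightarrow> bool" for S where
  "\<phi> \<in> S \<Longrightarrow> mp_derivable S \<phi>"
| "mp_derivable S (\<phi> \<^bold>\<Rightarrow> \<psi>) \<Longrightarrow> mp_derivable S \<phi> \<Longrightarrow> mp_derivable S \<psi>"

definition provable_L :: "'p form set \<Rightarrow> 'p form \<Rightarrow> bool"  (infix \<open>\<turnstile>\<close> 30) where
  "(S \<turnstile> \<phi>) \<longleftrightarrow> mp_derivable (logical_axioms formulas_L \<union> S) \<phi>"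

definition provable_Lplus :: "'p form set \<Rightarrow> 'p form \<Rightarrow> bool"  (infix \<open>\<turnstile>\<^sup>+\<close> 30) where
  "(S \<turnstile>\<^sup>+ \<phi>) \<longleftrightarrow> mp_derivable (logical_axioms formulas_Lplus \<union> definitional_axioms \<union> S) \<phi>"


section \<open>Translation\<close>

primrec G_rel :: "'p predicate \<Rightarrow> nat \<Rightarrow> nat \<Rightarrow> 'p form" where
  "G_rel (PVar p) x y = FRel x (PVar p) y"
| "G_rel PId x y = FRel x PId y"
| "G_rel (PPlus A B) x y = (G_rel A x y \<^bold>\<or> G_rel B x y)"
| "G_rel (PCompl A) x y = FNot (G_rel A x y)"
| "G_rel (PComp A B) x y =
     (let z = (LEAST z. z \<noteq> x \<and> z \<noteq> y) in FEx z (G_rel A x z \<^bold>\<and> G_rel B z y))"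
| "G_rel (PConv A) x y = G_rel A y x"

fun G_atom :: "'p atom \<Rightarrow> 'p form" where
  "G_atom (At x A y) = G_rel A x y"

fun G_eqn :: "'p equation \<Rightarrow> 'p form" where
  "G_eqn (A \<doteq> B) = univ_closure (G_rel A 0 1 \<^bold>\<longleftrightarrow> G_rel B 0 1)"

primrec G :: "'p form \<Rightarrow> 'p form" where
  "G (FAtom a) = G_atom a"
| "G (FEqn e) = G_eqn e"
| "G (\<phi> \<^bold>\<Rightarrow> \<psi>) = (G \<phi> \<^bold>\<Rightarrow> G \<psi>)"
| "G (FNot \<phi>) = FNot (G \<phi>)"
| "G (FAll x \<phi>) = FAll x (G \<phi>)"


section \<open>Sequent calculus\<close>

text \<open>The sets may be infinite.  A context such as \<open>\<Gamma>, xAy\<close> is \<open>insert (At x A y) \<Gamma>\<close>, where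
  \<open>xAy \<in> \<Gamma>\<close> is permitted.\<close>

type_synonym 'p sequent = "'p atom set \<times> 'p atom set"

inductive_set omega_provable :: "'p sequent set \<Rightarrow> 'p sequent set" for \<Theta> where
  given: "S \<in> \<Theta> \<Longrightarrow> S \<in> omega_provable \<Theta>"
| axiom: "\<Gamma> \<inter> \<Delta> \<noteq> {} \<Longrightarrow> (\<Gamma>, \<Delta>) \<in> omega_provable \<Theta>"
| axiom_id: "At x PId x \<in> \<Delta> \<Longrightarrow> (\<Gamma>, \<Delta>) \<in> omega_provable \<Theta>"
| cut: "(\<Gamma>, insert (At x A y) \<Delta>) \<in> omega_provable \<Theta> \<Longrightarrow>
    (insert (At x A y) \<Gamma>', \<Delta>') \<in> omega_provable \<Theta> \<Longrightarrow>
    (\<Gamma> \<union> \<Gamma>', \<Delta> \<union> \<Delta>') \<in> omega_provable \<Theta>"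
| equality: "(insert (At x A y) \<Gamma>, \<Delta>) \<in> omega_provable \<Theta> \<Longrightarrow>
    (insert (At x A z) (insert (At z PId y) \<Gamma>), \<Delta>) \<in> omega_provable \<Theta>"
| plus_left: "(insert (At x A y) \<Gamma>, \<Delta>) \<in> omega_provable \<Theta> \<Longrightarrow>
    (insert (At x B y) \<Gamma>', \<Delta>') \<in> omega_provable \<Theta> \<Longrightarrow>
    (insert (At x (PPlus A B) y) (\<Gamma> \<union> \<Gamma>'), \<Delta> \<union> \<Delta>') \<in> omega_provable \<Theta>"
| plus_right: "(\<Gamma>, insert (At x A y) (insert (At x B y) \<Delta>)) \<in> omega_provable \<Theta> \<Longrightarrow>
    (\<Gamma>, insert (At x (PPlus A B) y) \<Delta>) \<in> omega_provable \<Theta>"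
| compl_left: "(\<Gamma>, insert (At x A y) \<Delta>) \<in> omega_provable \<Theta> \<Longrightarrow>
    (insert (At x (PCompl A) y) \<Gamma>, \<Delta>) \<in> omega_provable \<Theta>"
| compl_right: "(insert (At x A y) \<Gamma>, \<Delta>) \<in> omega_provable \<Theta> \<Longrightarrow>
    (\<Gamma>, insert (At x (PCompl A) y) \<Delta>) \<in> omega_provable \<Theta>"
| comp_left: "(insert (At x A y) (insert (At y B z) \<Gamma>), \<Delta>) \<in> omega_provable \<Theta> \<Longrightarrow>
    y \<noteq> x \<Longrightarrow> y \<noteq> z \<Longrightarrow> \<forall>a \<in> \<Gamma> \<union> \<Delta>. y \<notin> atom_vars a \<Longrightarrow>
    (insert (At x (PComp A B) z) \<Gamma>, \<Delta>) \<in> omega_provable \<Theta>"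
| comp_right: "(\<Gamma>, insert (At x A y) \<Delta>) \<in> omega_provable \<Theta> \<Longrightarrow>
    (\<Gamma>', insert (At y B z) \<Delta>') \<in> omega_provable \<Theta> \<Longrightarrow>
    (\<Gamma> \<union> \<Gamma>', insert (At x (PComp A B) z) (\<Delta> \<union> \<Delta>')) \<in> omega_provable \<Theta>"
| conv_left: "(insert (At x A y) \<Gamma>, \<Delta>) \<in> omega_provable \<Theta> \<Longrightarrow>
    (insert (At y (PConv A) x) \<Gamma>, \<Delta>) \<in> omega_provable \<Theta>"
| conv_right: "(\<Gamma>, insert (At x A y) \<Delta>) \<in> omega_provable \<Theta> \<Longrightarrow>
    (\<Gamma>, insert (At y (PConv A) x) \<Delta>) \<in> omega_provable \<Theta>"

definition corresponding_sequents :: "'p equation set \<Rightarrow> 'p sequent set" where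
  "corresponding_sequents \<Psi> =
     {(insert (At i A j) \<Gamma>, insert (At i B j) \<Delta>) | i j A B \<Gamma> \<Delta>. (A \<doteq> B) \<in> \<Psi>} \<union>
     {(insert (At i B j) \<Gamma>, insert (At i A j) \<Delta>) | i j A B \<Gamma> \<Delta>. (A \<doteq> B) \<in> \<Psi>}"


section \<open>Logics\<close>

definition CT_omega_from :: "'p equation set \<Rightarrow> 'p predicate set" where
  "CT_omega_from \<Psi> = {A. FEqn ` \<Psi> \<turnstile>\<^sup>+ FEqn (pred_le PId A)}"

definition CT_omega :: "'p predicate set" where
  "CT_omega = CT_omega_from {}"

end

theory Submission
  imports Defs "HOL-Library.Multiset"
begin

text \<open>The implications form two cycles through the sequent calculus.  If the sequent is not
  provable, a Henkin construction on the variables \<open>v\<^sub>i\<close> yields a model over a quotient of the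
  variables, whose definable relations form a representable algebra refuting (c).  A proof of the
  sequent is turned into a derivation in both first-order formalisms at once: all that is used of
  a translation of the atoms \<open>xAy\<close> is that equals may be substituted into it and that it obeys the
  definitions of the operators.  Conversely, both formalisms are sound for the structure that a
  homomorphism into a proper relation algebra induces on each class of its equivalence relation.

  Propositional steps in the first-order formalisms are not derived: the axioms prove every
  formula that is true under all valuations which make the theorems true.\<close>

section \<open>Provability of all universal closures\<close>

text \<open>Two features of the formalisms shape the syntactic half. Modus ponens is the only rule,
  and each axiom is a closure whose quantifiers come in one fixed order; so generalization, and
  modus ponens between open formulas with different free variables, have to be earned. This is the
  purpose of \<open>D\<close>, which demands a proof of every closure. Moreover, the axioms
  instantiate \<open>\<forall>x \<phi>\<close> only at \<open>x\<close> itself. A variable can be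
  renamed only by introducing a fresh one equal to it and replacing occurrences in atoms, one at a
  time. The definitional axioms mention only the variables 0, 1 and 2, whereas sequents and
  translated formulas use all of them, so such renamings are needed throughout.

  The definable relations of the resulting model are countably many, which is why their algebra can
  be copied into any infinite type.\<close>

abbreviation alls :: "nat list \<Rightarrow> 'p form \<Rightarrow> 'p form" where
  "alls xs \<phi> \<equiv> foldr FAll xs \<phi>"

abbreviation FEq :: "nat \<Rightarrow> nat \<Rightarrow> 'p form" where
  "FEq x y \<equiv> FRel x PId y"

lemma finite_fvars: "finite (fvars \<phi>)"
proof (induction \<phi>)
  case (FAtom a)
  then show ?case by (cases a) auto
qed auto

lemma fvars_alls: "fvars (alls xs \<phi>) = fvars \<phi> - set xs"
  by (induction xs) auto

lemma fvars_connectives [simp]: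
  "fvars (\<phi> \<^bold>\<or> \<psi>) = fvars \<phi> \<union> fvars \<psi>"
  "fvars (\<phi> \<^bold>\<and> \<psi>) = fvars \<phi> \<union> fvars \<psi>"
  "fvars (\<phi> \<^bold>\<longleftrightarrow> \<psi>) = fvars \<phi> \<union> fvars \<psi>"
  "fvars (FEx x \<phi>) = fvars \<phi> - {x}"
  by (auto simp: FOr_def FAnd_def FIff_def FEx_def)

lemma fvars_univ_closure [simp]: "fvars (univ_closure \<phi>) = {}"
  by (simp add: univ_closure_def fvars_alls finite_fvars)

lemma univ_closure_sentence: "fvars \<phi> = {} \<Longrightarrow> univ_closure \<phi> = \<phi>"
  by (simp add: univ_closure_def)

text \<open>\<open>F\<close> is \<open>UNIV\<close> for one formalism and \<open>formulas_L\<close>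
  for the other; \<open>S\<close> also holds the definitional axioms and the hypotheses. The
  conditions on \<open>F\<close> are equivalences because arguments pass from a formula to its parts
  as well.\<close>

locale hilbert =
  fixes F :: "'p form set" and S :: "'p form set"
  assumes F_imp: "(\<phi> \<^bold>\<Rightarrow> \<psi>) \<in> F \<longleftrightarrow> \<phi> \<in> F \<and> \<psi> \<in> F"
    and F_not: "FNot \<phi> \<in> F \<longleftrightarrow> \<phi> \<in> F"
    and F_all: "FAll x \<phi> \<in> F \<longleftrightarrow> \<phi> \<in> F"
    and F_eq: "FEq x y \<in> F"
    and logical_axioms_S: "logical_axioms F \<subseteq> S"
begin

abbreviation pr :: "'p form \<Rightarrow> bool" where "pr \<equiv> mp_derivable S"

lemma F_alls: "alls xs \<phi> \<in> F \<longleftrightarrow> \<phi> \<in> F"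
  by (induction xs) (auto simp: F_all)

lemma F_connectives:
  "(\<phi> \<^bold>\<or> \<psi>) \<in> F \<longleftrightarrow> \<phi> \<in> F \<and> \<psi> \<in> F"
  "(\<phi> \<^bold>\<and> \<psi>) \<in> F \<longleftrightarrow> \<phi> \<in> F \<and> \<psi> \<in> F"
  "(\<phi> \<^bold>\<longleftrightarrow> \<psi>) \<in> F \<longleftrightarrow> \<phi> \<in> F \<and> \<psi> \<in> F"
  "FEx x \<phi> \<in> F \<longleftrightarrow> \<phi> \<in> F"
  by (auto simp: FOr_def FAnd_def FIff_def FEx_def F_imp F_not F_all)

lemmas F_simps = F_imp F_not F_all F_eq F_alls F_connectives

lemma pr_ax: "\<alpha> \<in> logical_axioms F \<Longrightarrow> pr \<alpha>"
  using logical_axioms_S by (auto intro: mp_derivable.intros)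

lemma pr_mp: "pr (\<phi> \<^bold>\<Rightarrow> \<psi>) \<Longrightarrow> pr \<phi> \<Longrightarrow> pr \<psi>"
  by (rule mp_derivable.intros(2))

text \<open>The closures under short prefixes make the quantifier axioms available below a prefix; this
  is the hypothesis of the induction on the length of the prefix.\<close>

definition closes_below :: "nat \<Rightarrow> bool" where
  "closes_below n \<longleftrightarrow> (\<forall>ys \<alpha>. length ys < n \<longrightarrow> \<alpha> \<in> F \<longrightarrow> pr (univ_closure \<alpha>) \<longrightarrow>
     fvars \<alpha> \<subseteq> set ys \<longrightarrow> pr (alls ys \<alpha>))"

lemma closes_belowD:
  "closes_below n \<Longrightarrow> length ys < n \<Longrightarrow> \<alpha> \<in> F \<Longrightarrow> pr (univ_closure \<alpha>) \<Longrightarrow> fvars \<alpha> \<subseteq> set ys \<Longrightarrow>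
    pr (alls ys \<alpha>)"
  by (auto simp: closes_below_def)

text \<open>The innermost quantifier is peeled off. Below the remaining, shorter prefix the
  distribution axiom is available by \<open>closes_below n\<close>, and the induction hypothesis
  serves twice, once for each of the two arrows of that axiom.\<close>

lemma alls_mp_below:
  assumes "closes_below n" "length ys \<le> n" "fvars \<phi> \<union> fvars \<psi> \<subseteq> set ys" "\<phi> \<in> F" "\<psi> \<in> F"
    and "pr (alls ys (\<phi> \<^bold>\<Rightarrow> \<psi>))" "pr (alls ys \<phi>)"
  shows "pr (alls ys \<psi>)"
  using assms(2-)
proof (induction ys arbitrary: \<phi> \<psi> rule: rev_induct)
  case Nil
  then show ?case using pr_mp by auto
next
  case (snoc y ys)
  have "pr (univ_closure (FAll y (\<phi> \<^bold>\<Rightarrow> \<psi>) \<^bold>\<Rightarrow> (FAll y \<phi> \<^bold>\<Rightarrow> FAll y \<psi>)))"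
    using snoc.prems by (intro pr_ax logical_axioms.intros)
  note closure = this
  have ax: "pr (alls ys (FAll y (\<phi> \<^bold>\<Rightarrow> \<psi>) \<^bold>\<Rightarrow> (FAll y \<phi> \<^bold>\<Rightarrow> FAll y \<psi>)))"
    by (rule closes_belowD[OF assms(1)]) (use closure snoc.prems in \<open>auto simp: F_simps\<close>)
  have "pr (alls ys (FAll y \<phi> \<^bold>\<Rightarrow> FAll y \<psi>))"
    by (rule snoc.IH[OF _ _ _ _ ax]) (use snoc.prems in \<open>auto simp: F_simps\<close>)
  note imp = this
  have "pr (alls ys (FAll y \<psi>))"
    by (rule snoc.IH[OF _ _ _ _ imp]) (use snoc.prems in \<open>auto simp: F_simps\<close>)
  then show ?case by simp
qed

lemma alls_ax_mp_below:
  assumes "closes_below n" "length ys < n" "fvars \<phi> \<union> fvars \<psi> \<subseteq> set ys" "\<phi> \<in> F" "\<psi> \<in> F"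
    and "univ_closure (\<phi> \<^bold>\<Rightarrow> \<psi>) \<in> logical_axioms F" "pr (alls ys \<phi>)"
  shows "pr (alls ys \<psi>)"
proof (rule alls_mp_below[OF assms(1) _ assms(3-5) _ assms(7)])
  show "pr (alls ys (\<phi> \<^bold>\<Rightarrow> \<psi>))"
    by (rule closes_belowD[OF assms(1)]) (use assms pr_ax[OF assms(6)] in \<open>auto simp: F_simps\<close>)
qed (use assms in simp)

lemma alls_swap_below:
  assumes "closes_below n" "length (as @ x # y # bs) \<le> n" "fvars \<phi> \<subseteq> set (as @ x # y # bs)"
    "\<phi> \<in> F" "pr (alls (as @ x # y # bs) \<phi>)"
  shows "pr (alls (as @ y # x # bs) \<phi>)"
proof -
  have "pr (alls as (FAll y (FAll x (alls bs \<phi>))))"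
    by (rule alls_ax_mp_below[of n as "FAll x (FAll y (alls bs \<phi>))"])
      (use assms in \<open>auto simp: F_simps fvars_alls intro!: logical_axioms.intros(4)\<close>)
  then show ?thesis by simp
qed

lemma alls_move_below:
  assumes "closes_below n" "\<phi> \<in> F"
  shows "length (as @ x # bs @ cs) \<le> n \<Longrightarrow> fvars \<phi> \<subseteq> set (as @ x # bs @ cs) \<Longrightarrow>
    pr (alls (as @ x # bs @ cs) \<phi>) \<Longrightarrow> pr (alls (as @ bs @ x # cs) \<phi>)"
proof (induction bs arbitrary: as)
  case (Cons b bs)
  have "pr (alls (as @ b # x # bs @ cs) \<phi>)"
    by (rule alls_swap_below[OF assms(1)]) (use Cons.prems assms in auto)
  then show ?case
    using Cons.IH[of "as @ [b]"] Cons.prems by (auto simp: insert_commute)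
qed simp

lemma alls_perm_below:
  assumes "closes_below n" "\<phi> \<in> F"
  shows "mset xs = mset ys \<Longrightarrow> length (as @ xs) \<le> n \<Longrightarrow> fvars \<phi> \<subseteq> set (as @ xs) \<Longrightarrow>
    pr (alls (as @ xs) \<phi>) \<Longrightarrow> pr (alls (as @ ys) \<phi>)"
proof (induction xs arbitrary: as ys)
  case (Cons x xs)
  have "x \<in> set ys"
    using mset_eq_setD[OF Cons.prems(1)] by auto
  then obtain bs cs where ys: "ys = bs @ x # cs"
    by (meson split_list)
  have perm: "mset xs = mset (bs @ cs)"
    using Cons.prems(1) ys by simp
  have same: "length xs = length (bs @ cs)" "set xs = set (bs @ cs)"
    using mset_eq_length[OF perm] mset_eq_setD[OF perm] by auto
  have "pr (alls ((as @ [x]) @ (bs @ cs)) \<phi>)"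
    by (rule Cons.IH[OF perm]) (use Cons.prems in auto)
  then show ?case
    using alls_move_below[OF assms, of as x bs cs] Cons.prems same ys by auto
qed simp

text \<open>A quantifier is vacuous either because its variable is not free or because the variable
  is bound again further in.\<close>

lemma alls_insert_below:
  assumes "closes_below n" "length (as @ x # bs) \<le> n" "fvars \<phi> \<subseteq> set (as @ bs)"
    "x \<notin> fvars \<phi> \<or> x \<in> set bs" "\<phi> \<in> F" "pr (alls (as @ bs) \<phi>)"
  shows "pr (alls (as @ x # bs) \<phi>)"
proof -
  have "pr (alls as (FAll x (alls bs \<phi>)))"
    by (rule alls_ax_mp_below[of n as "alls bs \<phi>"])
      (use assms in \<open>auto simp: F_simps fvars_alls intro!: logical_axioms.intros(7)\<close>)
  then show ?thesis by simp
qed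

text \<open>A prefix covering the free variables may contain a redundant entry, namely a variable
  that is not free or the outer one of two occurrences; then it arises from a shorter prefix by a
  vacuous quantifier. Otherwise it is a permutation of the canonical prefix and is reached by
  swaps.\<close>

lemma closes_below: "closes_below n"
proof (induction n)
  case 0
  then show ?case by (simp add: closes_below_def)
next
  case (Suc n)
  have "pr (alls ys \<alpha>)"
    if "length ys \<le> n" "\<alpha> \<in> F" "pr (univ_closure \<alpha>)" "fvars \<alpha> \<subseteq> set ys" for ys \<alpha>
    using that
  proof (induction "length ys" arbitrary: ys rule: less_induct)
    case less
    consider (redundant) as x bs where "ys = as @ x # bs" "x \<notin> fvars \<alpha> \<or> x \<in> set bs"
      | (exact) "distinct ys" "set ys = fvars \<alpha>"
    proof (cases "distinct ys")
      case True
      show ?thesis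
      proof (cases "set ys = fvars \<alpha>")
        case False
        then obtain x where "x \<in> set ys" "x \<notin> fvars \<alpha>" using less by blast
        then show ?thesis by (meson split_list that(1))
      qed (use True that in blast)
    next
      case False
      then obtain as bs cs x where "ys = as @ [x] @ bs @ [x] @ cs"
        using not_distinct_decomp by blast
      then show ?thesis using that(1)[of as x "bs @ [x] @ cs"] by simp
    qed
    then show ?case
    proof cases
      case redundant
      have shorter: "pr (alls (as @ bs) \<alpha>)" by (rule less.hyps) (use less.prems redundant in auto)
      show ?thesis
        unfolding redundant(1)
        by (rule alls_insert_below[OF Suc _ _ _ _ shorter]) (use redundant less.prems in auto)
    next
      case exact
      then have "mset (sorted_list_of_set (fvars \<alpha>)) = mset ys"
        by (metis distinct_sorted_list_of_set finite_fvars set_eq_iff_mset_eq_distinct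
            set_sorted_list_of_set)
      from alls_perm_below[OF Suc less.prems(2) this, of "[]"] less.prems
        mset_eq_length[OF this] mset_eq_setD[OF this]
      show ?thesis by (simp add: univ_closure_def)
    qed
  qed
  then show ?case by (auto simp: closes_below_def)
qed

section \<open>Derived rules for open formulas\<close>

lemma alls_if_closure:
  "\<alpha> \<in> F \<Longrightarrow> pr (univ_closure \<alpha>) \<Longrightarrow> fvars \<alpha> \<subseteq> set ys \<Longrightarrow> pr (alls ys \<alpha>)"
  using closes_belowD[OF closes_below, of ys "Suc (length ys)"] by simp

text \<open>Stands in for provability of open formulas. The prefix is free, with any order,
  repetitions and vacuous entries, since generalization appends a variable at its inner end and
  modus ponens has to bring two formulas under the same prefix.\<close>

definition D :: "'p form \<Rightarrow> bool" where
  "D \<phi> \<longleftrightarrow> \<phi> \<in> F \<and> (\<forall>ys. fvars \<phi> \<subseteq> set ys \<longrightarrow> pr (alls ys \<phi>))"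

lemma D_F: "D \<phi> \<Longrightarrow> \<phi> \<in> F"
  by (simp add: D_def)

lemma D_if_closure: "\<alpha> \<in> F \<Longrightarrow> pr (univ_closure \<alpha>) \<Longrightarrow> D \<alpha>"
  by (simp add: D_def alls_if_closure)

lemma D_ax: "\<alpha> \<in> F \<Longrightarrow> univ_closure \<alpha> \<in> logical_axioms F \<Longrightarrow> D \<alpha>"
  by (simp add: D_if_closure pr_ax)

lemma pr_if_D: "D \<phi> \<Longrightarrow> fvars \<phi> = {} \<Longrightarrow> pr \<phi>"
  unfolding D_def by (auto dest: spec[of _ "[]"])

lemma D_gen: "D \<phi> \<Longrightarrow> D (FAll x \<phi>)"
proof -
  assume D: "D \<phi>"
  have "pr (alls ys (FAll x \<phi>))" if "fvars \<phi> - {x} \<subseteq> set ys" for ys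
  proof -
    have "fvars \<phi> \<subseteq> set (ys @ [x])" using that by auto
    then have "pr (alls (ys @ [x]) \<phi>)" using D unfolding D_def by blast
    then show ?thesis by simp
  qed
  with D show ?thesis by (simp add: D_def F_all)
qed

lemma alls_mp:
  assumes "fvars \<phi> \<union> fvars \<psi> \<subseteq> set ys" "\<phi> \<in> F" "\<psi> \<in> F"
    and "pr (alls ys (\<phi> \<^bold>\<Rightarrow> \<psi>))" "pr (alls ys \<phi>)"
  shows "pr (alls ys \<psi>)"
  using alls_mp_below[OF closes_below order_refl assms] .

lemma alls_drop:
  assumes "\<phi> \<in> F" "fvars \<phi> \<subseteq> set ys" "pr (alls ys (alls zs \<phi>))"
  shows "pr (alls ys \<phi>)"
  using assms(3)
proof (induction zs)
  case (Cons z zs)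
  have "D (FAll z (alls zs \<phi>) \<^bold>\<Rightarrow> alls zs \<phi>)"
    using assms by (intro D_ax logical_axioms.intros) (auto simp: F_simps)
  then have drop: "pr (alls ys (FAll z (alls zs \<phi>) \<^bold>\<Rightarrow> alls zs \<phi>))"
    using assms by (auto simp: D_def fvars_alls)
  have "pr (alls ys (alls zs \<phi>))"
    by (rule alls_mp[OF _ _ _ drop]) (use assms Cons.prems in \<open>auto simp: fvars_alls F_simps\<close>)
  then show ?case by (rule Cons.IH)
qed simp

text \<open>The variables that are free in \<open>\<phi>\<close> but not covered by the prefix are
  appended to it on the inside. After modus ponens below the longer prefix they are removed again by
  the instantiation axiom.\<close>

lemma D_mp:
  assumes "D (\<phi> \<^bold>\<Rightarrow> \<psi>)" "D \<phi>"
  shows "D \<psi>"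
proof -
  have F: "\<phi> \<in> F" "\<psi> \<in> F" using D_F[OF assms(1)] by (auto simp: F_imp)
  have "pr (alls ys \<psi>)" if "fvars \<psi> \<subseteq> set ys" for ys
  proof -
    define zs where "zs = sorted_list_of_set (fvars \<phi>)"
    have "set zs = fvars \<phi>" by (simp add: zs_def finite_fvars)
    then have cover: "fvars (\<phi> \<^bold>\<Rightarrow> \<psi>) \<subseteq> set (ys @ zs)" "fvars \<phi> \<subseteq> set (ys @ zs)"
      using that by auto
    have mp: "pr (alls (ys @ zs) (\<phi> \<^bold>\<Rightarrow> \<psi>))" "pr (alls (ys @ zs) \<phi>)"
      using assms cover unfolding D_def by blast+
    have "pr (alls (ys @ zs) \<psi>)"
      using cover by (intro alls_mp[OF _ F mp]) simp
    then show ?thesis using alls_drop[of \<psi> ys zs] F that by simp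
  qed
  then show ?thesis by (simp add: D_def F)
qed

lemma D_if_pr_sentence: "\<phi> \<in> F \<Longrightarrow> fvars \<phi> = {} \<Longrightarrow> pr \<phi> \<Longrightarrow> D \<phi>"
  by (simp add: D_if_closure univ_closure_sentence)

end

section \<open>Tautological consequence\<close>

context hilbert
begin

text \<open>The derivation of the K and S combinators from Lukasiewicz's axioms follows the theorems
  luklem1 to luklem8 of the Metamath database.\<close>

lemma luk1: "\<phi> \<in> F \<Longrightarrow> \<psi> \<in> F \<Longrightarrow> \<xi> \<in> F \<Longrightarrow> D ((\<phi> \<^bold>\<Rightarrow> \<psi>) \<^bold>\<Rightarrow> ((\<psi> \<^bold>\<Rightarrow> \<xi>) \<^bold>\<Rightarrow> (\<phi> \<^bold>\<Rightarrow> \<xi>)))"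
  by (intro D_ax logical_axioms.intros) (auto simp: F_simps)

lemma luk2: "\<phi> \<in> F \<Longrightarrow> D ((FNot \<phi> \<^bold>\<Rightarrow> \<phi>) \<^bold>\<Rightarrow> \<phi>)"
  by (intro D_ax logical_axioms.intros) (auto simp: F_simps)

lemma luk3: "\<phi> \<in> F \<Longrightarrow> \<psi> \<in> F \<Longrightarrow> D (\<phi> \<^bold>\<Rightarrow> (FNot \<phi> \<^bold>\<Rightarrow> \<psi>))"
  by (intro D_ax logical_axioms.intros) (auto simp: F_simps)

lemma luk_trans: "D (\<phi> \<^bold>\<Rightarrow> \<psi>) \<Longrightarrow> D (\<psi> \<^bold>\<Rightarrow> \<xi>) \<Longrightarrow> D (\<phi> \<^bold>\<Rightarrow> \<xi>)"
  using luk1[of \<phi> \<psi> \<xi>] D_F[of "\<phi> \<^bold>\<Rightarrow> \<psi>"] D_F[of "\<psi> \<^bold>\<Rightarrow> \<xi>"] by (auto simp: F_imp intro: D_mp)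

lemma luk_syl: "D (\<phi> \<^bold>\<Rightarrow> \<psi>) \<Longrightarrow> \<xi> \<in> F \<Longrightarrow> D ((\<psi> \<^bold>\<Rightarrow> \<xi>) \<^bold>\<Rightarrow> (\<phi> \<^bold>\<Rightarrow> \<xi>))"
  using luk1[of \<phi> \<psi> \<xi>] D_F[of "\<phi> \<^bold>\<Rightarrow> \<psi>"] by (auto simp: F_imp intro: D_mp)

lemma luk4:
  assumes [simp]: "\<phi> \<in> F" "\<psi> \<in> F" "\<xi> \<in> F" "\<theta> \<in> F"
  shows "D ((\<phi> \<^bold>\<Rightarrow> FNot \<psi>) \<^bold>\<Rightarrow> (((\<phi> \<^bold>\<Rightarrow> \<xi>) \<^bold>\<Rightarrow> \<theta>) \<^bold>\<Rightarrow> (\<psi> \<^bold>\<Rightarrow> \<theta>)))"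
proof -
  have "D (((FNot \<psi> \<^bold>\<Rightarrow> \<xi>) \<^bold>\<Rightarrow> (\<phi> \<^bold>\<Rightarrow> \<xi>)) \<^bold>\<Rightarrow> (\<psi> \<^bold>\<Rightarrow> (\<phi> \<^bold>\<Rightarrow> \<xi>)))"
    by (rule luk_syl[OF luk3]) (simp_all add: F_simps)
  from luk_trans[OF luk1 this] have "D ((\<phi> \<^bold>\<Rightarrow> FNot \<psi>) \<^bold>\<Rightarrow> (\<psi> \<^bold>\<Rightarrow> (\<phi> \<^bold>\<Rightarrow> \<xi>)))"
    by (simp add: F_simps)
  then show ?thesis
    by (rule luk_trans[OF _ luk1]) (simp_all add: F_simps)
qed

lemma luk5:
  assumes [simp]: "\<phi> \<in> F" "\<psi> \<in> F" "\<xi> \<in> F" "\<theta> \<in> F"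
  shows "D (\<phi> \<^bold>\<Rightarrow> (((FNot \<phi> \<^bold>\<Rightarrow> \<psi>) \<^bold>\<Rightarrow> \<xi>) \<^bold>\<Rightarrow> (\<theta> \<^bold>\<Rightarrow> \<xi>)))"
  by (rule luk_trans[OF luk3 luk4]) (simp_all add: F_simps)

lemma luk6:
  assumes [simp]: "\<phi> \<in> F" "\<psi> \<in> F"
  shows "D ((((FNot \<phi> \<^bold>\<Rightarrow> \<phi>) \<^bold>\<Rightarrow> \<phi>) \<^bold>\<Rightarrow> \<psi>) \<^bold>\<Rightarrow> \<psi>)"
proof -
  let ?P = "(FNot \<phi> \<^bold>\<Rightarrow> \<phi>) \<^bold>\<Rightarrow> \<phi>"
  have F [simp]: "?P \<in> F" by (simp add: F_simps)
  have "D (((FNot ?P \<^bold>\<Rightarrow> ?P) \<^bold>\<Rightarrow> ?P) \<^bold>\<Rightarrow> (FNot \<psi> \<^bold>\<Rightarrow> ?P))"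
    by (rule D_mp[OF luk5 luk2]) (simp_all add: F_simps)
  then have "D (FNot \<psi> \<^bold>\<Rightarrow> ?P)"
    by (rule D_mp[OF _ luk2]) (rule F)
  then have "D ((?P \<^bold>\<Rightarrow> \<psi>) \<^bold>\<Rightarrow> (FNot \<psi> \<^bold>\<Rightarrow> \<psi>))"
    by (rule luk_syl) simp
  then show ?thesis
    by (rule luk_trans[OF _ luk2]) simp
qed

lemma luk_K:
  assumes [simp]: "\<phi> \<in> F" "\<psi> \<in> F"
  shows "D (\<phi> \<^bold>\<Rightarrow> (\<psi> \<^bold>\<Rightarrow> \<phi>))"
  by (rule luk_trans[OF luk5 luk6]) (simp_all add: F_simps)

lemma luk_W:
  assumes [simp]: "\<phi> \<in> F" "\<psi> \<in> F"
  shows "D ((\<phi> \<^bold>\<Rightarrow> (\<phi> \<^bold>\<Rightarrow> \<psi>)) \<^bold>\<Rightarrow> (\<phi> \<^bold>\<Rightarrow> \<psi>))"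
proof -
  let ?A = "\<phi> \<^bold>\<Rightarrow> \<psi>"
  have F: "?A \<in> F" by (simp add: F_simps)
  have "D (FNot ?A \<^bold>\<Rightarrow> (((FNot \<psi> \<^bold>\<Rightarrow> \<psi>) \<^bold>\<Rightarrow> \<psi>) \<^bold>\<Rightarrow> (?A \<^bold>\<Rightarrow> \<psi>)))"
    by (rule luk_trans[OF luk_K luk4]) (simp_all add: F_simps)
  then have "D (FNot ?A \<^bold>\<Rightarrow> (?A \<^bold>\<Rightarrow> \<psi>))"
    by (rule luk_trans[OF _ luk6]) (simp_all add: F_simps)
  then have "D (((?A \<^bold>\<Rightarrow> \<psi>) \<^bold>\<Rightarrow> ?A) \<^bold>\<Rightarrow> (FNot ?A \<^bold>\<Rightarrow> ?A))"
    by (rule luk_syl) (rule F)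
  from luk_trans[OF this luk2[OF F]] have "D (((?A \<^bold>\<Rightarrow> \<psi>) \<^bold>\<Rightarrow> ?A) \<^bold>\<Rightarrow> ?A)" .
  then show ?thesis
    by (rule luk_trans[OF luk1, rotated 3]) (simp_all add: F_simps)
qed

lemma luk_C:
  assumes [simp]: "\<phi> \<in> F" "\<psi> \<in> F" "\<xi> \<in> F"
  shows "D ((\<phi> \<^bold>\<Rightarrow> (\<psi> \<^bold>\<Rightarrow> \<xi>)) \<^bold>\<Rightarrow> (\<psi> \<^bold>\<Rightarrow> (\<phi> \<^bold>\<Rightarrow> \<xi>)))"
proof -
  let ?A = "\<psi> \<^bold>\<Rightarrow> \<xi>"
  have "D (\<psi> \<^bold>\<Rightarrow> (?A \<^bold>\<Rightarrow> (?A \<^bold>\<Rightarrow> \<xi>)))"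
    by (rule luk_trans[OF luk_K luk1]) (simp_all add: F_simps)
  then have "D (\<psi> \<^bold>\<Rightarrow> (?A \<^bold>\<Rightarrow> \<xi>))"
    by (rule luk_trans[OF _ luk_W]) (simp_all add: F_simps)
  then have "D (((?A \<^bold>\<Rightarrow> \<xi>) \<^bold>\<Rightarrow> (\<phi> \<^bold>\<Rightarrow> \<xi>)) \<^bold>\<Rightarrow> (\<psi> \<^bold>\<Rightarrow> (\<phi> \<^bold>\<Rightarrow> \<xi>)))"
    by (rule luk_syl) (simp add: F_simps)
  then show ?thesis
    by (rule luk_trans[OF luk1, rotated 3]) (simp_all add: F_simps)
qed

lemma luk_S:
  assumes [simp]: "\<phi> \<in> F" "\<psi> \<in> F" "\<xi> \<in> F"
  shows "D ((\<phi> \<^bold>\<Rightarrow> (\<psi> \<^bold>\<Rightarrow> \<xi>)) \<^bold>\<Rightarrow> ((\<phi> \<^bold>\<Rightarrow> \<psi>) \<^bold>\<Rightarrow> (\<phi> \<^bold>\<Rightarrow> \<xi>)))"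
proof -
  have B: "D ((\<beta> \<^bold>\<Rightarrow> \<gamma>) \<^bold>\<Rightarrow> ((\<alpha> \<^bold>\<Rightarrow> \<beta>) \<^bold>\<Rightarrow> (\<alpha> \<^bold>\<Rightarrow> \<gamma>)))"
    if "\<alpha> \<in> F" "\<beta> \<in> F" "\<gamma> \<in> F" for \<alpha> \<beta> \<gamma>
    by (rule D_mp[OF luk_C luk1]) (use that in \<open>simp_all add: F_simps\<close>)
  have W: "D (((\<phi> \<^bold>\<Rightarrow> \<psi>) \<^bold>\<Rightarrow> (\<phi> \<^bold>\<Rightarrow> (\<phi> \<^bold>\<Rightarrow> \<xi>))) \<^bold>\<Rightarrow> ((\<phi> \<^bold>\<Rightarrow> \<psi>) \<^bold>\<Rightarrow> (\<phi> \<^bold>\<Rightarrow> \<xi>)))"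
    by (rule D_mp[OF B luk_W]) (simp_all add: F_simps)
  have "D ((\<phi> \<^bold>\<Rightarrow> (\<psi> \<^bold>\<Rightarrow> \<xi>)) \<^bold>\<Rightarrow> ((\<phi> \<^bold>\<Rightarrow> \<psi>) \<^bold>\<Rightarrow> (\<phi> \<^bold>\<Rightarrow> (\<phi> \<^bold>\<Rightarrow> \<xi>))))"
    by (rule luk_trans[OF luk_C B]) (simp_all add: F_simps)
  then show ?thesis
    by (rule luk_trans[OF _ W])
qed

section \<open>Deduction theorem and maximal sets\<close>

abbreviation ded :: "'p form set \<Rightarrow> 'p form \<Rightarrow> bool" where
  "ded M \<equiv> mp_derivable (Collect D \<union> M)"

lemma ded_F: "ded M \<phi> \<Longrightarrow> M \<subseteq> F \<Longrightarrow> \<phi> \<in> F"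
  by (induction rule: mp_derivable.induct) (auto simp: F_imp dest: D_F)

lemma ded_D: "D \<phi> \<Longrightarrow> ded M \<phi>"
  by (auto intro: mp_derivable.intros)

lemmas ded_mp = mp_derivable.intros(2)[of "Collect D \<union> M" for M]

lemma ded_mem: "\<phi> \<in> M \<Longrightarrow> ded M \<phi>"
  by (auto intro: mp_derivable.intros)

lemma ded_mono: "ded M \<phi> \<Longrightarrow> M \<subseteq> N \<Longrightarrow> ded N \<phi>"
  by (induction rule: mp_derivable.induct) (auto intro: mp_derivable.intros)

text \<open>In \<open>ded\<close> everything in \<open>D\<close> counts as an axiom and modus ponens
  is the only rule. Generalization happens inside \<open>D\<close> and never touches the hypotheses,
  which is why \<open>\<psi>\<close> may be open.\<close>

lemma deduction_theorem:
  assumes "ded (insert \<psi> M) \<phi>" "\<psi> \<in> F" "M \<subseteq> F"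
  shows "ded M (\<psi> \<^bold>\<Rightarrow> \<phi>)"
  using assms(1)
proof (induction rule: mp_derivable.induct)
  case (1 \<phi>)
  show ?case
  proof (cases "\<phi> = \<psi>")
    case True
    have "D (\<psi> \<^bold>\<Rightarrow> \<psi>)"
      using D_mp[OF luk_W luk_K] assms(2) by blast
    then show ?thesis using True ded_D by simp
  next
    case False
    then have "ded M \<phi>" using 1 by (auto intro: mp_derivable.intros)
    then show ?thesis
      using ded_mp[OF ded_D[OF luk_K]] ded_F assms by blast
  qed
next
  case (2 \<phi> \<xi>)
  have "\<phi> \<in> F" "\<xi> \<in> F"
    using ded_F[OF 2(3)] assms by (auto simp: F_imp)
  then show ?case
    using ded_mp[OF ded_mp[OF ded_D[OF luk_S] "2.IH"(1)] "2.IH"(2)] assms by blast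
qed

lemma ded_finite:
  "ded M \<phi> \<Longrightarrow> \<exists>X. finite X \<and> X \<subseteq> M \<and> ded X \<phi>"
proof (induction rule: mp_derivable.induct)
  case (1 \<phi>)
  then show ?case
    by (intro exI[of _ "M \<inter> {\<phi>}"]) (auto intro: mp_derivable.intros)
next
  case (2 \<phi> \<psi>)
  then obtain X Y where "finite X" "X \<subseteq> M" "ded X (\<phi> \<^bold>\<Rightarrow> \<psi>)" "finite Y" "Y \<subseteq> M" "ded Y \<phi>"
    by blast
  then show ?case
    by (intro exI[of _ "X \<union> Y"]) (auto intro: mp_derivable.intros ded_mono)
qed

text \<open>Only implication and negation are interpreted; atoms, equations and quantified formulas
  act as propositional letters. The last clause imports whatever has been derived about quantifiers
  and equality.\<close>

definition valuation :: "('p form \<Rightarrow> bool) \<Rightarrow> bool" where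
  "valuation v \<longleftrightarrow> (\<forall>\<phi>\<in>F. \<forall>\<psi>\<in>F. v (\<phi> \<^bold>\<Rightarrow> \<psi>) = (v \<phi> \<longrightarrow> v \<psi>)) \<and>
     (\<forall>\<phi>\<in>F. v (FNot \<phi>) = (\<not> v \<phi>)) \<and> (\<forall>\<phi>. D \<phi> \<longrightarrow> v \<phi>)"

lemma valuation_D: "valuation v \<Longrightarrow> D \<phi> \<Longrightarrow> v \<phi>"
  by (simp add: valuation_def)

lemma valuation_simps:
  assumes "valuation v" "\<phi> \<in> F"
  shows "v (FNot \<phi>) \<longleftrightarrow> \<not> v \<phi>"
    and "\<psi> \<in> F \<Longrightarrow> v (\<phi> \<^bold>\<Rightarrow> \<psi>) \<longleftrightarrow> (v \<phi> \<longrightarrow> v \<psi>)"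
    and "\<psi> \<in> F \<Longrightarrow> v (\<phi> \<^bold>\<or> \<psi>) \<longleftrightarrow> v \<phi> \<or> v \<psi>"
    and "\<psi> \<in> F \<Longrightarrow> v (\<phi> \<^bold>\<and> \<psi>) \<longleftrightarrow> v \<phi> \<and> v \<psi>"
    and "\<psi> \<in> F \<Longrightarrow> v (\<phi> \<^bold>\<longleftrightarrow> \<psi>) \<longleftrightarrow> (v \<phi> \<longleftrightarrow> v \<psi>)"
  using assms by (auto simp: valuation_def FOr_def FAnd_def FIff_def F_simps)

text \<open>Zorn's lemma among the sets that do not deduce \<open>\<phi>\<close>. Unions of chains
  stay in this family because a deduction uses finitely many hypotheses, and the empty set belongs
  to it because \<open>D\<close> is closed under modus ponens.\<close>

lemma maximal_avoiding:
  assumes "\<not> D \<phi>" "\<phi> \<in> F"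
  obtains M where "M \<subseteq> F" "\<not> ded M \<phi>"
    "\<And>\<psi>. \<psi> \<in> F \<Longrightarrow> \<psi> \<notin> M \<Longrightarrow> ded (insert \<psi> M) \<phi>"
proof -
  let ?A = "{M. M \<subseteq> F \<and> \<not> ded M \<phi>}"
  have "D \<psi>" if "ded {} \<psi>" for \<psi>
    using that by (induction rule: mp_derivable.induct) (auto intro: D_mp)
  then have "{} \<in> ?A" using assms by auto
  moreover have "\<Union>C \<in> ?A" if chain: "C \<noteq> {}" "subset.chain ?A C" for C
  proof -
    have "\<not> ded (\<Union>C) \<phi>"
    proof
      assume "ded (\<Union>C) \<phi>"
      then obtain X where X: "finite X" "X \<subseteq> \<Union>C" "ded X \<phi>"
        using ded_finite by blast
      obtain M where "M \<in> C" "X \<subseteq> M"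
        using finite_subset_Union_chain[OF X(1,2) chain] by metis
      then have "ded M \<phi>" using ded_mono[OF X(3)] by blast
      moreover have "M \<in> ?A"
        using chain(2) \<open>M \<in> C\<close> unfolding subset.chain_def by blast
      ultimately show False by simp
    qed
    moreover have "\<Union>C \<subseteq> F"
      using chain(2) unfolding subset.chain_def by blast
    ultimately show ?thesis by simp
  qed
  ultimately have "\<exists>M\<in>?A. \<forall>X\<in>?A. M \<subseteq> X \<longrightarrow> X = M"
    by (intro subset_Zorn_nonempty) blast+
  then obtain M where M: "M \<subseteq> F" "\<not> ded M \<phi>"
    and max: "\<And>X. X \<subseteq> F \<Longrightarrow> \<not> ded X \<phi> \<Longrightarrow> M \<subseteq> X \<Longrightarrow> X = M"
    by (metis (no_types, lifting) mem_Collect_eq)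
  have "ded (insert \<psi> M) \<phi>" if "\<psi> \<in> F" "\<psi> \<notin> M" for \<psi>
    using max[of "insert \<psi> M"] that M(1) by (metis insertI1 insert_subset subset_insertI)
  with M show thesis using that by blast
qed

text \<open>Membership in a maximal set that does not deduce \<open>\<phi>\<close> commutes with
  negation and implication, so it is a valuation that makes \<open>\<phi>\<close> false.\<close>

theorem tautological_consequence:
  assumes "\<phi> \<in> F" "\<And>v. valuation v \<Longrightarrow> v \<phi>"
  shows "D \<phi>"
proof (rule ccontr)
  assume "\<not> D \<phi>"
  then obtain M where M: "M \<subseteq> F" "\<not> ded M \<phi>"
    "\<And>\<psi>. \<psi> \<in> F \<Longrightarrow> \<psi> \<notin> M \<Longrightarrow> ded (insert \<psi> M) \<phi>"
    using maximal_avoiding assms(1) by blast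
  have ded_imp: "ded M (\<psi> \<^bold>\<Rightarrow> \<phi>)" if "\<psi> \<in> F" "\<psi> \<notin> M" for \<psi>
    using deduction_theorem[OF M(3)[OF that] that(1) M(1)] .
  have closed: "\<psi> \<in> M" if "ded M \<psi>" for \<psi>
    using ded_mp[OF ded_imp that] ded_F[OF that M(1)] M(2) by blast
  have mem: "ded M \<psi>" if "\<psi> \<in> M" for \<psi>
    using that by (rule ded_mem)
  have D_M: "\<psi> \<in> M" if "D \<psi>" for \<psi>
    using closed ded_D that by blast
  have mp: "\<xi> \<in> M" if "(\<psi> \<^bold>\<Rightarrow> \<xi>) \<in> M" "\<psi> \<in> M" for \<psi> \<xi>
    using closed[OF ded_mp[OF mem mem]] that by blast
  have phi: "\<phi> \<notin> M" using M(2) mem by blast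
  have neg: "FNot \<psi> \<in> M \<longleftrightarrow> \<psi> \<notin> M" if "\<psi> \<in> F" for \<psi>
  proof
    assume "FNot \<psi> \<in> M"
    then show "\<psi> \<notin> M"
      using D_M[OF luk3[OF that assms(1)]] mp phi by blast
  next
    assume 1: "\<psi> \<notin> M"
    show "FNot \<psi> \<in> M"
    proof (rule ccontr)
      assume "FNot \<psi> \<notin> M"
      then have n: "(FNot \<psi> \<^bold>\<Rightarrow> \<phi>) \<in> M"
        using ded_imp closed that by (simp add: F_not)
      \<comment> \<open>If neither \<open>\<psi>\<close> nor its negation is in \<open>M\<close>,
        both imply \<open>\<phi>\<close>. Under the hypothesis \<open>FNot \<phi>\<close> the
        negation of \<open>\<psi>\<close> then yields a contradiction and hence
        \<open>\<psi>\<close>; so \<open>\<psi>\<close> holds, therefore \<open>\<phi>\<close>. Thus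
        \<open>FNot \<phi>\<close> implies \<open>\<phi>\<close>, and the axiom in
        \<open>luk2\<close> gives \<open>\<phi>\<close> outright.\<close>
      define N where "N = insert (FNot \<psi>) (insert (FNot \<phi>) M)"
      have "ded N \<phi>"
        by (rule ded_mp[OF ded_mem ded_mem]) (use n in \<open>auto simp: N_def\<close>)
      moreover have "ded N (FNot \<phi>)"
        by (rule ded_mem) (simp add: N_def)
      ultimately have "ded N \<psi>"
        using ded_mp[OF ded_mp[OF ded_D[OF luk3[OF assms(1) that]]]] by blast
      then have "ded (insert (FNot \<phi>) M) (FNot \<psi> \<^bold>\<Rightarrow> \<psi>)"
        unfolding N_def by (rule deduction_theorem) (use that M(1) assms(1) in \<open>auto simp: F_not\<close>)
      then have "ded (insert (FNot \<phi>) M) \<psi>"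
        by (rule ded_mp[OF ded_D[OF luk2[OF that]]])
      moreover have "ded (insert (FNot \<phi>) M) (\<psi> \<^bold>\<Rightarrow> \<phi>)"
        using ded_mono[OF ded_imp[OF that 1]] by blast
      ultimately have "ded (insert (FNot \<phi>) M) \<phi>"
        using ded_mp by blast
      then have "ded M (FNot \<phi> \<^bold>\<Rightarrow> \<phi>)"
        by (rule deduction_theorem) (use M(1) assms(1) in \<open>auto simp: F_not\<close>)
      then show False
        using ded_mp[OF ded_D[OF luk2[OF assms(1)]]] M(2) by blast
    qed
  qed
  have imp: "(\<psi> \<^bold>\<Rightarrow> \<xi>) \<in> M \<longleftrightarrow> (\<psi> \<in> M \<longrightarrow> \<xi> \<in> M)" if F: "\<psi> \<in> F" "\<xi> \<in> F" for \<psi> \<xi>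
  proof
    assume "\<psi> \<in> M \<longrightarrow> \<xi> \<in> M"
    show "(\<psi> \<^bold>\<Rightarrow> \<xi>) \<in> M"
    proof (cases "\<xi> \<in> M")
      case True
      then show ?thesis using D_M[OF luk_K[OF F(2,1)]] mp by blast
    next
      case False
      then have "FNot \<psi> \<in> M"
        using \<open>\<psi> \<in> M \<longrightarrow> \<xi> \<in> M\<close> neg F by blast
      then have "ded (insert \<psi> M) \<xi>"
        by (intro ded_mp[OF ded_mp[OF ded_D[OF luk3[OF F]] ded_mem] ded_mem]) auto
      then show ?thesis
        using closed deduction_theorem F(1) M(1) by blast
    qed
  qed (use mp in blast)
  have "valuation (\<lambda>\<psi>. \<psi> \<in> M)"
    unfolding valuation_def using neg imp D_M by simp
  then show False using assms(2) phi by blast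
qed

end

section \<open>Quantifiers, equality and substitution\<close>

context hilbert
begin

section \<open>Derived rules for quantifiers and equality\<close>

lemma D_inst: "\<phi> \<in> F \<Longrightarrow> D (FAll x \<phi> \<^bold>\<Rightarrow> \<phi>)"
  by (intro D_ax logical_axioms.intros) (auto simp: F_simps)

lemma D_all_mono:
  assumes "D (\<phi> \<^bold>\<Rightarrow> \<psi>)"
  shows "D (FAll x \<phi> \<^bold>\<Rightarrow> FAll x \<psi>)"
proof -
  have "\<phi> \<in> F" "\<psi> \<in> F" using D_F[OF assms] by (auto simp: F_imp)
  then have "D (FAll x (\<phi> \<^bold>\<Rightarrow> \<psi>) \<^bold>\<Rightarrow> (FAll x \<phi> \<^bold>\<Rightarrow> FAll x \<psi>))"
    by (intro D_ax logical_axioms.intros) (auto simp: F_simps)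
  then show ?thesis using D_mp D_gen[OF assms] by blast
qed

lemma D_vacuous: "\<phi> \<in> F \<Longrightarrow> x \<notin> fvars \<phi> \<Longrightarrow> D (\<phi> \<^bold>\<Rightarrow> FAll x \<phi>)"
  by (intro D_ax logical_axioms.intros) (auto simp: F_simps)

lemma D_exI:
  assumes "\<phi> \<in> F"
  shows "D (\<phi> \<^bold>\<Rightarrow> FEx x \<phi>)"
proof (rule tautological_consequence)
  fix v assume v: "valuation v"
  from valuation_D[OF v D_inst[of "FNot \<phi>" x]] assms show "v (\<phi> \<^bold>\<Rightarrow> FEx x \<phi>)"
    by (auto simp: FEx_def valuation_simps[OF v] F_simps)
qed (use assms in \<open>simp add: F_simps\<close>)

lemma D_exE:
  assumes "D (\<phi> \<^bold>\<Rightarrow> \<psi>)" "x \<notin> fvars \<psi>"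
  shows "D (FEx x \<phi> \<^bold>\<Rightarrow> \<psi>)"
proof (rule tautological_consequence)
  have F: "\<phi> \<in> F" "\<psi> \<in> F" using D_F[OF assms(1)] by (auto simp: F_imp)
  then show "(FEx x \<phi> \<^bold>\<Rightarrow> \<psi>) \<in> F" by (simp add: F_simps)
  have "D (FNot \<psi> \<^bold>\<Rightarrow> FNot \<phi>)"
  proof (rule tautological_consequence)
    fix v assume v: "valuation v"
    from valuation_D[OF v assms(1)] F show "v (FNot \<psi> \<^bold>\<Rightarrow> FNot \<phi>)"
      by (auto simp: valuation_simps[OF v] F_simps)
  qed (use F in \<open>simp add: F_simps\<close>)
  note 1 = D_all_mono[OF this, of x]
  have 2: "D (FNot \<psi> \<^bold>\<Rightarrow> FAll x (FNot \<psi>))"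
    by (rule D_vacuous) (use F assms(2) in \<open>auto simp: F_simps\<close>)
  fix v assume v: "valuation v"
  from valuation_D[OF v 1] valuation_D[OF v 2] F show "v (FEx x \<phi> \<^bold>\<Rightarrow> \<psi>)"
    by (auto simp: FEx_def valuation_simps[OF v] F_simps)
qed

lemma D_ex_eq: "x \<noteq> y \<Longrightarrow> D (FEx x (FEq x y))"
  by (intro D_ax logical_axioms.intros) (auto simp: F_simps)

text \<open>The axiom that something equals \<open>y\<close> discharges the assumption
  \<open>FEq x y\<close> once \<open>x\<close> has disappeared from the conclusion. All renaming of
  variables goes through this rule.\<close>

lemma D_by_fresh_copy:
  assumes "D (FEq x y \<^bold>\<Rightarrow> \<phi>)" "x \<noteq> y" "x \<notin> fvars \<phi>"
  shows "D \<phi>"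
  using D_mp[OF D_exE[OF assms(1,3)] D_ex_eq[OF assms(2)]] .

lemma D_replace:
  "FAtom a \<in> F \<Longrightarrow> FAtom b \<in> F \<Longrightarrow> replace_one x y a b \<Longrightarrow> D (FEq x y \<^bold>\<Rightarrow> (FAtom a \<^bold>\<Rightarrow> FAtom b))"
  by (intro D_ax logical_axioms.intros) (auto simp: F_simps)

lemma D_refl: "D (FEq x x)"
proof (rule D_by_fresh_copy)
  let ?z = "Suc x"
  \<comment> \<open>The atom \<open>FEq ?z x\<close> is used twice: as the equation, and as the atom
    in which the left variable \<open>?z\<close> is replaced by \<open>x\<close>.\<close>
  have 1: "D (FEq ?z x \<^bold>\<Rightarrow> (FEq ?z x \<^bold>\<Rightarrow> FEq x x))"
    by (intro D_replace replace_one.intros F_eq)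
  show "D (FEq ?z x \<^bold>\<Rightarrow> FEq x x)"
  proof (rule tautological_consequence)
    fix v assume v: "valuation v"
    from valuation_D[OF v 1] show "v (FEq ?z x \<^bold>\<Rightarrow> FEq x x)"
      by (auto simp: valuation_simps[OF v] F_simps)
  qed (simp add: F_simps)
qed auto

lemma D_sym: "D (FEq x y \<^bold>\<Rightarrow> FEq y x)"
proof (rule tautological_consequence)
  \<comment> \<open>Symmetry arises by replacing only the left occurrence of \<open>x\<close> in
    \<open>FEq x x\<close>.\<close>
  have 1: "D (FEq x y \<^bold>\<Rightarrow> (FEq x x \<^bold>\<Rightarrow> FEq y x))"
    by (intro D_replace replace_one.intros F_eq)
  fix v assume v: "valuation v"
  from valuation_D[OF v 1] valuation_D[OF v D_refl] show "v (FEq x y \<^bold>\<Rightarrow> FEq y x)"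
    by (auto simp: valuation_simps[OF v] F_simps)
qed (simp add: F_simps)

text \<open>The formalism has no substitution.  Its part is played by families \<open>\<phi> x y\<close> of formulas that
  provably respect equality in both variables.\<close>

definition binary :: "(nat \<Rightarrow> nat \<Rightarrow> 'p form) \<Rightarrow> bool" where
  "binary \<phi> \<longleftrightarrow> (\<forall>x y. \<phi> x y \<in> F \<and> fvars (\<phi> x y) \<subseteq> {x, y} \<and>
     (\<forall>x' y'. D (FEq x x' \<^bold>\<Rightarrow> FEq y y' \<^bold>\<Rightarrow> \<phi> x y \<^bold>\<Rightarrow> \<phi> x' y')))"

lemma binaryI:
  assumes "\<And>x y. \<phi> x y \<in> F" "\<And>x y. fvars (\<phi> x y) \<subseteq> {x, y}"
    and "\<And>v x y x' y'. valuation v \<Longrightarrow> v (FEq x x') \<Longrightarrow> v (FEq y y') \<Longrightarrow> v (\<phi> x y) \<Longrightarrow> v (\<phi> x' y')"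
  shows "binary \<phi>"
  unfolding binary_def
proof (intro allI conjI assms(1,2))
  fix x y x' y'
  show "D (FEq x x' \<^bold>\<Rightarrow> FEq y y' \<^bold>\<Rightarrow> \<phi> x y \<^bold>\<Rightarrow> \<phi> x' y')"
  proof (rule tautological_consequence)
    fix v assume v: "valuation v"
    then show "v (FEq x x' \<^bold>\<Rightarrow> FEq y y' \<^bold>\<Rightarrow> \<phi> x y \<^bold>\<Rightarrow> \<phi> x' y')"
      using assms(3)[OF v] by (simp add: valuation_simps[OF v] F_simps assms(1))
  qed (simp add: F_simps assms(1))
qed

lemma binary_F: "binary \<phi> \<Longrightarrow> \<phi> x y \<in> F"
  by (simp add: binary_def)

lemma binary_fvars: "binary \<phi> \<Longrightarrow> fvars (\<phi> x y) \<subseteq> {x, y}"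
  by (simp add: binary_def)

lemma binary_subst:
  assumes "binary \<phi>" "valuation v" "v (FEq x x')" "v (FEq y y')" "v (\<phi> x y)"
  shows "v (\<phi> x' y')"
proof -
  have "v (FEq x x' \<^bold>\<Rightarrow> FEq y y' \<^bold>\<Rightarrow> \<phi> x y \<^bold>\<Rightarrow> \<phi> x' y')"
    by (rule valuation_D[OF assms(2)]) (use assms(1) in \<open>simp add: binary_def\<close>)
  with assms(3-) show ?thesis
    by (simp add: valuation_simps[OF assms(2)] F_simps binary_F[OF assms(1)])
qed

lemma val_sym:
  assumes v: "valuation v" and "v (FEq x y)"
  shows "v (FEq y x)"
  using valuation_D[OF v D_sym, of x y] assms(2) by (simp add: valuation_simps[OF v] F_simps)

lemma val_refl: "valuation v \<Longrightarrow> v (FEq x x)"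
  using valuation_D[OF _ D_refl] .

lemma binary_atom:
  assumes "\<And>x y. FRel x A y \<in> F"
  shows "binary (\<lambda>x y. FRel x A y)"
proof (rule binaryI)
  fix v x y x' y' assume v: "valuation v" and eq: "v (FEq x x')" "v (FEq y y')" and a: "v (FRel x A y)"
  have "D (FEq x x' \<^bold>\<Rightarrow> (FRel x A y \<^bold>\<Rightarrow> FRel x' A y))" "D (FEq y y' \<^bold>\<Rightarrow> (FRel x' A y \<^bold>\<Rightarrow> FRel x' A y'))"
    by (intro D_replace replace_one.intros assms)+
  from valuation_D[OF v this(1)] valuation_D[OF v this(2)] eq a show "v (FRel x' A y')"
    by (simp add: valuation_simps[OF v] F_simps assms)
qed (use assms in auto)

lemma binary_imp:
  assumes "binary \<phi>" "binary \<psi>"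
  shows "binary (\<lambda>x y. \<phi> x y \<^bold>\<Rightarrow> \<psi> x y)"
proof -
  note F = binary_F[OF assms(1)] binary_F[OF assms(2)]
  show ?thesis
  proof (rule binaryI)
    fix v x y x' y' assume v: "valuation v" and eq: "v (FEq x x')" "v (FEq y y')"
      and "v (\<phi> x y \<^bold>\<Rightarrow> \<psi> x y)"
    then have "v (\<phi> x y) \<longrightarrow> v (\<psi> x y)" by (simp add: valuation_simps[OF v] F)
    moreover have "v (\<phi> x' y') \<longrightarrow> v (\<phi> x y)"
      using binary_subst[OF assms(1) v val_sym[OF v eq(1)] val_sym[OF v eq(2)]] by blast
    ultimately show "v (\<phi> x' y' \<^bold>\<Rightarrow> \<psi> x' y')"
      using binary_subst[OF assms(2) v eq] by (simp add: valuation_simps[OF v] F)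
  qed (use binary_fvars[OF assms(1)] binary_fvars[OF assms(2)] F in \<open>auto simp: F_simps\<close>)
qed

lemma binary_not:
  assumes "binary \<phi>"
  shows "binary (\<lambda>x y. FNot (\<phi> x y))"
proof -
  note F = binary_F[OF assms]
  show ?thesis
  proof (rule binaryI)
    fix v x y x' y' assume v: "valuation v" and eq: "v (FEq x x')" "v (FEq y y')"
      and "v (FNot (\<phi> x y))"
    then show "v (FNot (\<phi> x' y'))"
      using binary_subst[OF assms v val_sym[OF v eq(1)] val_sym[OF v eq(2)]]
      by (auto simp: valuation_simps[OF v] F)
  qed (use binary_fvars[OF assms] F in \<open>auto simp: F_simps\<close>)
qed

lemma binary_or: "binary \<phi> \<Longrightarrow> binary \<psi> \<Longrightarrow> binary (\<lambda>x y. \<phi> x y \<^bold>\<or> \<psi> x y)"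
  unfolding FOr_def by (intro binary_imp binary_not)

lemma binary_and: "binary \<phi> \<Longrightarrow> binary \<psi> \<Longrightarrow> binary (\<lambda>x y. \<phi> x y \<^bold>\<and> \<psi> x y)"
  unfolding FAnd_def by (intro binary_imp binary_not)

lemma binary_iff: "binary \<phi> \<Longrightarrow> binary \<psi> \<Longrightarrow> binary (\<lambda>x y. \<phi> x y \<^bold>\<longleftrightarrow> \<psi> x y)"
  unfolding FIff_def by (intro binary_imp binary_and)

lemma binary_converse:
  assumes "binary \<phi>"
  shows "binary (\<lambda>x y. \<phi> y x)"
proof (rule binaryI)
  show "fvars (\<phi> y x) \<subseteq> {x, y}" for x y
    using binary_fvars[OF assms, of y x] by blast
qed (use binary_F[OF assms] binary_subst[OF assms] in blast)+

text \<open>Carries the definitional axioms from the variables 0 and 1 to arbitrary ones. The pair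
  \<open>a, b\<close> may overlap with \<open>x, y\<close>, and \<open>x\<close> may equal
  \<open>y\<close>; hence the detour through two distinct variables that differ from all
  four.\<close>

lemma D_binary_generalize:
  assumes "binary \<phi>" "a \<noteq> b" "D (\<phi> a b)"
  shows "D (\<phi> x y)"
proof -
  have step: "D (\<phi> x y)"
    if ab: "D (\<phi> a b)" "a \<noteq> b" and fresh: "a \<notin> {x, y}" "b \<notin> {x, y}" for a b x y
  proof -
    have "D (FEq a x \<^bold>\<Rightarrow> FEq b y \<^bold>\<Rightarrow> \<phi> x y)"
    proof (rule tautological_consequence)
      fix v assume v: "valuation v"
      show "v (FEq a x \<^bold>\<Rightarrow> FEq b y \<^bold>\<Rightarrow> \<phi> x y)"
        using binary_subst[OF assms(1) v _ _ valuation_D[OF v ab(1)]]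
        by (simp add: valuation_simps[OF v] F_simps binary_F[OF assms(1)])
    qed (simp add: F_simps binary_F[OF assms(1)])
    moreover have "a \<notin> fvars (\<phi> x y)" "b \<notin> fvars (\<phi> x y)"
      using fresh binary_fvars[OF assms(1)] by blast+
    \<comment> \<open>The copy \<open>a\<close> is discharged while the equation for
      \<open>b\<close> is still a premise; this is where \<open>a \<noteq> b\<close> enters.\<close>
    ultimately show ?thesis
      using fresh \<open>a \<noteq> b\<close> D_by_fresh_copy[of a x "FEq b y \<^bold>\<Rightarrow> \<phi> x y"] D_by_fresh_copy[of b y "\<phi> x y"]
      by auto
  qed
  define u where "u = Suc (a + b + x + y)"
  have u: "u \<notin> {a, b, x, y}" "Suc u \<notin> {a, b, x, y}"
    by (auto simp: u_def)
  have "D (\<phi> u (Suc u))"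
    by (rule step[OF assms(3,2)]) (use u in auto)
  then show ?thesis
    by (rule step) (use u in auto)
qed

text \<open>The bound variable is a parameter because the translation chooses it depending on
  \<open>x\<close> and \<open>y\<close>, and the sequent rule dictates an eigenvariable. By
  \<open>fcomp_rename\<close> any two admissible choices are equivalent.\<close>

definition fcomp :: "(nat \<Rightarrow> nat \<Rightarrow> 'p form) \<Rightarrow> (nat \<Rightarrow> nat \<Rightarrow> 'p form) \<Rightarrow> nat \<Rightarrow> nat \<Rightarrow> nat \<Rightarrow> 'p form"
  where "fcomp \<phi> \<psi> w x y = FEx w (\<phi> x w \<^bold>\<and> \<psi> w y)"

lemma fcomp_F: "binary \<phi> \<Longrightarrow> binary \<psi> \<Longrightarrow> fcomp \<phi> \<psi> w x y \<in> F"
  by (simp add: fcomp_def F_simps binary_F)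

lemma fcomp_fvars:
  assumes "binary \<phi>" "binary \<psi>"
  shows "fvars (fcomp \<phi> \<psi> w x y) \<subseteq> {x, y} - {w}"
  using binary_fvars[OF assms(1), of x w] binary_fvars[OF assms(2), of w y]
  by (auto simp: fcomp_def)

text \<open>Ordinary existential introduction covers only the case in which the witness
  \<open>y\<close> is the bound variable \<open>w\<close>. Otherwise \<open>w\<close> is taken as a
  fresh copy of \<open>y\<close>, which allows \<open>y\<close> to coincide with \<open>x\<close> or
  \<open>z\<close>.\<close>

lemma D_fcompI:
  assumes "binary \<phi>" "binary \<psi>" "w \<notin> {x, z}"
  shows "D (\<phi> x y \<^bold>\<and> \<psi> y z \<^bold>\<Rightarrow> fcomp \<phi> \<psi> w x z)"
proof -
  note F = binary_F[OF assms(1)] binary_F[OF assms(2)] fcomp_F[OF assms(1,2)]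
  have I: "D (\<phi> x w \<^bold>\<and> \<psi> w z \<^bold>\<Rightarrow> fcomp \<phi> \<psi> w x z)"
    unfolding fcomp_def by (rule D_exI) (simp add: F_simps F)
  show ?thesis
  proof (cases "w = y")
    case False
    show ?thesis
    proof (rule D_by_fresh_copy)
      show "D (FEq w y \<^bold>\<Rightarrow> \<phi> x y \<^bold>\<and> \<psi> y z \<^bold>\<Rightarrow> fcomp \<phi> \<psi> w x z)"
      proof (rule tautological_consequence)
        fix v assume v: "valuation v"
        show "v (FEq w y \<^bold>\<Rightarrow> \<phi> x y \<^bold>\<and> \<psi> y z \<^bold>\<Rightarrow> fcomp \<phi> \<psi> w x z)"
          using valuation_D[OF v I] binary_subst[OF assms(1) v val_refl[OF v, of x], of y w]
            binary_subst[OF assms(2) v _ val_refl[OF v, of z], of y w] val_sym[OF v, of w y]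
          by (auto simp: valuation_simps[OF v] F_simps F)
      qed (simp add: F_simps F)
      show "w \<notin> fvars (\<phi> x y \<^bold>\<and> \<psi> y z \<^bold>\<Rightarrow> fcomp \<phi> \<psi> w x z)"
        using binary_fvars[OF assms(1), of x y] binary_fvars[OF assms(2), of y z]
          fcomp_fvars[OF assms(1,2), of w x z] assms(3) False by auto
    qed (rule False)
  qed (use I in simp)
qed

lemma fcomp_rename:
  assumes "binary \<phi>" "binary \<psi>" "w \<notin> {x, y}" "w' \<notin> {x, y}"
  shows "D (fcomp \<phi> \<psi> w x y \<^bold>\<Rightarrow> fcomp \<phi> \<psi> w' x y)"
proof -
  have "w \<notin> fvars (fcomp \<phi> \<psi> w' x y)"
    using fcomp_fvars[OF assms(1,2), of w' x y] assms(3) by auto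
  with D_exE[OF D_fcompI[OF assms(1,2,4)]] show ?thesis
    unfolding fcomp_def[of \<phi> \<psi> w] .
qed

text \<open>The bound variable for \<open>x, y\<close> may be one of \<open>x', y'\<close>, so the
  equations cannot simply be moved under the quantifier. It is first renamed to a variable
  \<open>u\<close> outside all four and afterwards to the one chosen for
  \<open>x', y'\<close>.\<close>

lemma binary_fcomp:
  assumes "binary \<phi>" "binary \<psi>" "\<And>x y. w x y \<notin> {x, y}"
  shows "binary (\<lambda>x y. fcomp \<phi> \<psi> (w x y) x y)"
proof (rule binaryI)
  note F = binary_F[OF assms(1)] binary_F[OF assms(2)] fcomp_F[OF assms(1,2)]
  fix v x y x' y' assume v: "valuation v" and eq: "v (FEq x x')" "v (FEq y y')"
    and comp: "v (fcomp \<phi> \<psi> (w x y) x y)"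
  define u where "u = Suc (x + y + x' + y')"
  have u: "u \<notin> {x, y, x', y'}" by (auto simp: u_def)
  let ?E = "FEq x x' \<^bold>\<and> FEq y y'"
  \<comment> \<open>The equations follow the conjunction, so that they are part of the conclusion
    for \<open>D_exE\<close>, in which \<open>u\<close> is not free.\<close>
  have "D ((\<phi> x u \<^bold>\<and> \<psi> u y) \<^bold>\<Rightarrow> ?E \<^bold>\<Rightarrow> fcomp \<phi> \<psi> u x' y')"
  proof (rule tautological_consequence)
    have I: "D (\<phi> x' u \<^bold>\<and> \<psi> u y' \<^bold>\<Rightarrow> fcomp \<phi> \<psi> u x' y')"
      unfolding fcomp_def by (rule D_exI) (simp add: F_simps F)
    fix v assume v: "valuation v"
    show "v ((\<phi> x u \<^bold>\<and> \<psi> u y) \<^bold>\<Rightarrow> ?E \<^bold>\<Rightarrow> fcomp \<phi> \<psi> u x' y')"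
      using valuation_D[OF v I] binary_subst[OF assms(1) v _ val_refl[OF v, of u], of x x']
        binary_subst[OF assms(2) v val_refl[OF v, of u], of y y']
      by (auto simp: valuation_simps[OF v] F_simps F)
  qed (simp add: F_simps F)
  then have "D (FEx u (\<phi> x u \<^bold>\<and> \<psi> u y) \<^bold>\<Rightarrow> ?E \<^bold>\<Rightarrow> fcomp \<phi> \<psi> u x' y')"
    by (rule D_exE) (use u fcomp_fvars[OF assms(1,2), of u x' y'] in auto)
  then have "D (fcomp \<phi> \<psi> u x y \<^bold>\<Rightarrow> ?E \<^bold>\<Rightarrow> fcomp \<phi> \<psi> u x' y')"
    by (simp add: fcomp_def)
  moreover have "D (fcomp \<phi> \<psi> (w x y) x y \<^bold>\<Rightarrow> fcomp \<phi> \<psi> u x y)"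
    "D (fcomp \<phi> \<psi> u x' y' \<^bold>\<Rightarrow> fcomp \<phi> \<psi> (w x' y') x' y')"
    by (rule fcomp_rename; use assms u in auto)+
  ultimately have "v (fcomp \<phi> \<psi> u x y \<^bold>\<Rightarrow> ?E \<^bold>\<Rightarrow> fcomp \<phi> \<psi> u x' y')"
    "v (fcomp \<phi> \<psi> (w x y) x y \<^bold>\<Rightarrow> fcomp \<phi> \<psi> u x y)"
    "v (fcomp \<phi> \<psi> u x' y' \<^bold>\<Rightarrow> fcomp \<phi> \<psi> (w x' y') x' y')"
    using valuation_D[OF v] by blast+
  then show "v (fcomp \<phi> \<psi> (w x' y') x' y')"
    using eq comp by (simp add: valuation_simps[OF v] F_simps F)
qed (use fcomp_F[OF assms(1,2)] fcomp_fvars[OF assms(1,2)] in blast)+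

end

section \<open>From sequents to formulas\<close>

lemma least_other: "(LEAST z::nat. z \<noteq> x \<and> z \<noteq> y) \<noteq> x" "(LEAST z::nat. z \<noteq> x \<and> z \<noteq> y) \<noteq> y"
proof -
  have "Suc (x + y) \<noteq> x \<and> Suc (x + y) \<noteq> y" by simp
  from LeastI[of "\<lambda>z. z \<noteq> x \<and> z \<noteq> y", OF this]
  show "(LEAST z::nat. z \<noteq> x \<and> z \<noteq> y) \<noteq> x" "(LEAST z::nat. z \<noteq> x \<and> z \<noteq> y) \<noteq> y"
    by blast+
qed

text \<open>There are two instances: the atom \<open>xAy\<close> itself, where the clauses are
  definitional axioms moved to arbitrary variables, and \<open>G_rel\<close>, where the two sides of
  each equivalence are the same formula.\<close>

locale atom_translation = hilbert F S for F S :: "'p form set" +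
  fixes T :: "'p predicate \<Rightarrow> nat \<Rightarrow> nat \<Rightarrow> 'p form"
  assumes T_binary: "binary (T A)"
    and T_PId: "T PId x y = FEq x y"
    and T_plus: "D (T (PPlus A B) x y \<^bold>\<longleftrightarrow> T A x y \<^bold>\<or> T B x y)"
    and T_compl: "D (T (PCompl A) x y \<^bold>\<longleftrightarrow> FNot (T A x y))"
    and T_comp: "D (T (PComp A B) x y \<^bold>\<longleftrightarrow> fcomp (T A) (T B) (LEAST z. z \<noteq> x \<and> z \<noteq> y) x y)"
    and T_conv: "D (T (PConv A) x y \<^bold>\<longleftrightarrow> T A y x)"
begin

lemmas T_F = binary_F[OF T_binary]

section \<open>Sequents under valuations\<close>

fun TA :: "'p atom \<Rightarrow> 'p form" where
  "TA (At x A y) = T A x y"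

lemma TA_F: "TA a \<in> F"
  by (cases a) (simp add: T_F)

lemma TA_fvars: "fvars (TA a) \<subseteq> atom_vars a"
  using binary_fvars[OF T_binary] by (cases a) simp

lemma val_T:
  assumes v: "valuation v"
  shows "v (T (PPlus A B) x y) \<longleftrightarrow> v (T A x y) \<or> v (T B x y)"
    and "v (T (PCompl A) x y) \<longleftrightarrow> \<not> v (T A x y)"
    and "v (T (PConv A) x y) \<longleftrightarrow> v (T A y x)"
  using valuation_D[OF v T_plus, of A B x y] valuation_D[OF v T_compl, of A x y]
    valuation_D[OF v T_conv, of A x y]
  by (simp_all add: valuation_simps[OF v] F_simps T_F)

lemma val_T_comp:
  assumes v: "valuation v" and w: "w \<notin> {x, y}"
  shows "v (T (PComp A B) x y) \<longleftrightarrow> v (fcomp (T A) (T B) w x y)"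
proof -
  let ?w = "LEAST z. z \<noteq> x \<and> z \<noteq> y"
  have "?w \<notin> {x, y}" using least_other by blast
  then have "v (fcomp (T A) (T B) w x y \<^bold>\<Rightarrow> fcomp (T A) (T B) ?w x y)"
    "v (fcomp (T A) (T B) ?w x y \<^bold>\<Rightarrow> fcomp (T A) (T B) w x y)"
    using valuation_D[OF v fcomp_rename[OF T_binary T_binary]] w by blast+
  with valuation_D[OF v T_comp, of A B x y] show ?thesis
    by (auto simp: valuation_simps[OF v] F_simps T_F fcomp_F[OF T_binary T_binary])
qed

lemma val_T_compI:
  assumes v: "valuation v" and "v (T A x y)" "v (T B y z)"
  shows "v (T (PComp A B) x z)"
proof -
  let ?w = "LEAST w. w \<noteq> x \<and> w \<noteq> z"
  have w: "?w \<notin> {x, z}" using least_other by blast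
  from valuation_D[OF v D_fcompI[OF T_binary T_binary w], of A y B] assms
  show ?thesis
    by (simp add: val_T_comp[OF v w] valuation_simps[OF v] F_simps T_F fcomp_F[OF T_binary T_binary])
qed

text \<open>The empty disjunction must be false without contributing a free variable, since
  otherwise that variable could not serve as an eigenvariable; hence a negated quantified
  equation.\<close>

definition sequent_form :: "'p atom list \<Rightarrow> 'p atom list \<Rightarrow> 'p form" where
  "sequent_form gs ds =
     foldr (\<lambda>a \<phi>. TA a \<^bold>\<Rightarrow> \<phi>) gs (foldr (\<lambda>a \<phi>. TA a \<^bold>\<or> \<phi>) ds (FNot (FAll 0 (FEq 0 0))))"

lemma sequent_form_F: "sequent_form gs ds \<in> F"
proof -
  have "foldr (\<lambda>a \<phi>. TA a \<^bold>\<or> \<phi>) ds (FNot (FAll 0 (FEq 0 0))) \<in> F"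
    by (induction ds) (simp_all add: F_simps TA_F)
  then show ?thesis
    unfolding sequent_form_def by (induction gs) (simp_all add: F_simps TA_F)
qed

lemma sequent_form_fvars: "fvars (sequent_form gs ds) \<subseteq> (\<Union>a\<in>set gs \<union> set ds. atom_vars a)"
proof -
  have "fvars (foldr (\<lambda>a \<phi>. TA a \<^bold>\<or> \<phi>) ds (FNot (FAll 0 (FEq 0 0)))) = (\<Union>a\<in>set ds. fvars (TA a))"
    by (induction ds) auto
  then have "fvars (sequent_form gs ds) = (\<Union>a\<in>set gs \<union> set ds. fvars (TA a))"
    unfolding sequent_form_def by (induction gs) auto
  then show ?thesis using TA_fvars by fastforce
qed

lemma val_sequent_form:
  assumes v: "valuation v"
  shows "v (sequent_form gs ds) \<longleftrightarrow> ((\<forall>a\<in>set gs. v (TA a)) \<longrightarrow> (\<exists>a\<in>set ds. v (TA a)))"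
proof -
  let ?r = "\<lambda>ds. foldr (\<lambda>a \<phi>. TA a \<^bold>\<or> \<phi>) ds (FNot (FAll 0 (FEq 0 0)))"
  have F: "?r ds \<in> F" for ds
    by (induction ds) (simp_all add: F_simps TA_F)
  have r: "v (?r ds) \<longleftrightarrow> (\<exists>a\<in>set ds. v (TA a))" for ds
    using valuation_D[OF v D_gen[OF D_refl]]
    by (induction ds) (simp_all add: valuation_simps[OF v] F_simps TA_F F)
  have "sequent_form gs ds \<in> F" for gs by (rule sequent_form_F)
  then show ?thesis
    by (induction gs) (auto simp: r valuation_simps[OF v] TA_F sequent_form_def)
qed

text \<open>For finite sets this amounts to provability of the formula in
  \<open>sequent_form\<close>, by \<open>tautological_consequence\<close>. Phrased with valuations,
  it lets the propositional rules be checked on truth values of atoms.\<close>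

definition entails :: "'p atom set \<Rightarrow> 'p atom set \<Rightarrow> bool" where
  "entails \<Gamma> \<Delta> \<longleftrightarrow> (\<forall>v. valuation v \<longrightarrow> (\<forall>a\<in>\<Gamma>. v (TA a)) \<longrightarrow> (\<exists>a\<in>\<Delta>. v (TA a)))"

text \<open>Here the sequent has to be one formula: its context becomes \<open>?\<chi>\<close>, in
  which the eigenvariable \<open>y\<close> is not free, and \<open>y\<close> itself is then taken as
  the bound variable of the relative product.\<close>

lemma entails_comp_left:
  assumes fin: "finite \<Gamma>" "finite \<Delta>"
    and ent: "entails (insert (At x A y) (insert (At y B z) \<Gamma>)) \<Delta>"
    and fresh: "y \<noteq> x" "y \<noteq> z" "\<forall>a\<in>\<Gamma> \<union> \<Delta>. y \<notin> atom_vars a"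
  shows "entails (insert (At x (PComp A B) z) \<Gamma>) \<Delta>"
proof -
  obtain gs ds where gs: "set gs = \<Gamma>" "set ds = \<Delta>"
    using finite_list fin by metis
  let ?\<chi> = "sequent_form gs ds"
  have "D (T A x y \<^bold>\<and> T B y z \<^bold>\<Rightarrow> ?\<chi>)"
  proof (rule tautological_consequence)
    fix v assume v: "valuation v"
    with ent show "v (T A x y \<^bold>\<and> T B y z \<^bold>\<Rightarrow> ?\<chi>)"
      by (auto simp: entails_def valuation_simps[OF v] F_simps T_F sequent_form_F
          val_sequent_form[OF v] gs)
  qed (simp add: F_simps T_F sequent_form_F)
  moreover have "y \<notin> fvars ?\<chi>"
    using sequent_form_fvars[of gs ds] fresh(3) gs by auto
  ultimately have D: "D (fcomp (T A) (T B) y x z \<^bold>\<Rightarrow> ?\<chi>)"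
    unfolding fcomp_def by (rule D_exE)
  show ?thesis
    unfolding entails_def
  proof (intro allI impI)
    fix v assume v: "valuation v" and \<Gamma>: "\<forall>a\<in>insert (At x (PComp A B) z) \<Gamma>. v (TA a)"
    have "v (fcomp (T A) (T B) y x z)"
      using val_T_comp[OF v, of y x z A B] fresh \<Gamma> by simp
    then have "v ?\<chi>"
      using valuation_D[OF v D]
      by (simp add: valuation_simps[OF v] F_simps sequent_form_F fcomp_F[OF T_binary T_binary])
    then show "\<exists>a\<in>\<Delta>. v (TA a)"
      using \<Gamma> by (simp add: val_sequent_form[OF v] gs)
  qed
qed

text \<open>Contexts may be infinite, but the left rule for relative products corresponds to a
  quantification over a formula, which can only express a finite part of the context.\<close>

definition finitely_entails :: "'p atom set \<Rightarrow> 'p atom set \<Rightarrow> bool" where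
  "finitely_entails \<Gamma> \<Delta> \<longleftrightarrow>
     (\<exists>\<Gamma>\<^sub>0 \<Delta>\<^sub>0. finite \<Gamma>\<^sub>0 \<and> finite \<Delta>\<^sub>0 \<and> \<Gamma>\<^sub>0 \<subseteq> \<Gamma> \<and> \<Delta>\<^sub>0 \<subseteq> \<Delta> \<and> entails \<Gamma>\<^sub>0 \<Delta>\<^sub>0)"

lemma finitely_entailsI:
  "finite \<Gamma>\<^sub>0 \<Longrightarrow> finite \<Delta>\<^sub>0 \<Longrightarrow> \<Gamma>\<^sub>0 \<subseteq> \<Gamma> \<Longrightarrow> \<Delta>\<^sub>0 \<subseteq> \<Delta> \<Longrightarrow> entails \<Gamma>\<^sub>0 \<Delta>\<^sub>0 \<Longrightarrow> finitely_entails \<Gamma> \<Delta>"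
  unfolding finitely_entails_def by blast

lemma entails_mono: "entails \<Gamma> \<Delta> \<Longrightarrow> \<Gamma> \<subseteq> \<Gamma>' \<Longrightarrow> \<Delta> \<subseteq> \<Delta>' \<Longrightarrow> entails \<Gamma>' \<Delta>'"
  unfolding entails_def by blast

text \<open>\<open>A\<close> and \<open>B\<close> hold the principal atoms of a rule. By
  monotonicity they may be added to the finite parts; what else those parts contain lies in the
  contexts.\<close>

lemma finitely_entailsE:
  assumes "finitely_entails (A \<union> \<Gamma>) (B \<union> \<Delta>)" "finite A" "finite B"
  obtains \<Gamma>\<^sub>0 \<Delta>\<^sub>0 where "finite \<Gamma>\<^sub>0" "finite \<Delta>\<^sub>0" "\<Gamma>\<^sub>0 \<subseteq> \<Gamma>" "\<Delta>\<^sub>0 \<subseteq> \<Delta>" "entails (A \<union> \<Gamma>\<^sub>0) (B \<union> \<Delta>\<^sub>0)"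
proof -
  obtain G D where *: "finite G" "finite D" "G \<subseteq> A \<union> \<Gamma>" "D \<subseteq> B \<union> \<Delta>" "entails G D"
    using assms(1) unfolding finitely_entails_def by blast
  have "entails (A \<union> (G - A)) (B \<union> (D - B))"
    by (rule entails_mono[OF *(5)]) auto
  then show thesis
    by (rule that[rotated 4]) (use * in auto)
qed

lemma finitely_entails_one:
  assumes "finitely_entails (A \<union> \<Gamma>) (B \<union> \<Delta>)" "finite A" "finite B" "finite A'" "finite B'"
    and "\<And>\<Gamma>\<^sub>0 \<Delta>\<^sub>0. finite \<Gamma>\<^sub>0 \<Longrightarrow> finite \<Delta>\<^sub>0 \<Longrightarrow> \<Gamma>\<^sub>0 \<subseteq> \<Gamma> \<Longrightarrow> \<Delta>\<^sub>0 \<subseteq> \<Delta> \<Longrightarrow>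
      entails (A \<union> \<Gamma>\<^sub>0) (B \<union> \<Delta>\<^sub>0) \<Longrightarrow> entails (A' \<union> \<Gamma>\<^sub>0) (B' \<union> \<Delta>\<^sub>0)"
  shows "finitely_entails (A' \<union> \<Gamma>) (B' \<union> \<Delta>)"
proof -
  obtain \<Gamma>\<^sub>0 \<Delta>\<^sub>0 where *: "finite \<Gamma>\<^sub>0" "finite \<Delta>\<^sub>0" "\<Gamma>\<^sub>0 \<subseteq> \<Gamma>" "\<Delta>\<^sub>0 \<subseteq> \<Delta>" "entails (A \<union> \<Gamma>\<^sub>0) (B \<union> \<Delta>\<^sub>0)"
    using finitely_entailsE[OF assms(1-3)] by blast
  show ?thesis
    by (rule finitely_entailsI[OF _ _ _ _ assms(6)[OF *]]) (use * assms(4,5) in auto)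
qed

text \<open>The last hypothesis is the rule read backwards: a valuation refuting the principal part
  of the conclusion refutes that of one of the premises.\<close>

lemma finitely_entails_two:
  assumes "finitely_entails (A\<^sub>1 \<union> \<Gamma>) (B\<^sub>1 \<union> \<Delta>)" "finite A\<^sub>1" "finite B\<^sub>1"
    and "finitely_entails (A\<^sub>2 \<union> \<Gamma>') (B\<^sub>2 \<union> \<Delta>')" "finite A\<^sub>2" "finite B\<^sub>2" "finite A" "finite B"
    and "\<And>v. valuation v \<Longrightarrow> (\<forall>a\<in>A. v (TA a)) \<Longrightarrow> (\<forall>a\<in>B. \<not> v (TA a)) \<Longrightarrow>
      (\<forall>a\<in>A\<^sub>1. v (TA a)) \<and> (\<forall>a\<in>B\<^sub>1. \<not> v (TA a)) \<or> (\<forall>a\<in>A\<^sub>2. v (TA a)) \<and> (\<forall>a\<in>B\<^sub>2. \<not> v (TA a))"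
  shows "finitely_entails (A \<union> (\<Gamma> \<union> \<Gamma>')) (B \<union> (\<Delta> \<union> \<Delta>'))"
proof -
  obtain G D where 1: "finite G" "finite D" "G \<subseteq> \<Gamma>" "D \<subseteq> \<Delta>" "entails (A\<^sub>1 \<union> G) (B\<^sub>1 \<union> D)"
    using finitely_entailsE[OF assms(1-3)] by blast
  obtain G' D' where 2: "finite G'" "finite D'" "G' \<subseteq> \<Gamma>'" "D' \<subseteq> \<Delta>'" "entails (A\<^sub>2 \<union> G') (B\<^sub>2 \<union> D')"
    using finitely_entailsE[OF assms(4-6)] by blast
  have "entails (A \<union> (G \<union> G')) (B \<union> (D \<union> D'))"
    unfolding entails_def
  proof (intro allI impI)
    fix v assume v: "valuation v" and true: "\<forall>a\<in>A \<union> (G \<union> G'). v (TA a)"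
    show "\<exists>a\<in>B \<union> (D \<union> D'). v (TA a)"
    proof (rule ccontr)
      assume "\<not> ?thesis"
      with 1(5) 2(5) assms(9)[OF v] v true show False
        unfolding entails_def by blast
    qed
  qed
  then show ?thesis
    by (rule finitely_entailsI[rotated 4]) (use 1 2 assms(7,8) in auto)
qed

text \<open>The eigenvariable condition is inherited by the finite parts of a context, so the rule
  for relative products can be applied to them and the rest of the context added afterwards.\<close>

theorem omega_provable_entails:
  assumes \<Psi>: "\<And>A B. (A \<doteq> B) \<in> \<Psi> \<Longrightarrow> D (T A 0 1 \<^bold>\<longleftrightarrow> T B 0 1)"
    and "s \<in> omega_provable (corresponding_sequents \<Psi>)"
  shows "finitely_entails (fst s) (snd s)"
  using assms(2)
proof (induction s rule: omega_provable.induct)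
  case (given s)
  have entails: "entails {At i A j} {At i B j}" "entails {At i B j} {At i A j}"
    if "(A \<doteq> B) \<in> \<Psi>" for i A j B
  proof -
    \<comment> \<open>The hypothesis on \<open>\<Psi>\<close> concerns the variables 0 and 1, the
      given sequents arbitrary \<open>i\<close> and \<open>j\<close>, possibly equal ones.\<close>
    have "D (T A i j \<^bold>\<longleftrightarrow> T B i j)"
      by (rule D_binary_generalize[OF binary_iff[OF T_binary T_binary] _ \<Psi>[OF that]]) simp
    then have iff: "v (T A i j) \<longleftrightarrow> v (T B i j)" if v: "valuation v" for v
      using valuation_D[OF v, of "T A i j \<^bold>\<longleftrightarrow> T B i j"] by (simp add: valuation_simps[OF v] T_F)
    show "entails {At i A j} {At i B j}" "entails {At i B j} {At i A j}"
      unfolding entails_def by (auto dest: iff)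
  qed
  from given obtain A B i j \<Gamma> \<Delta> where "(A \<doteq> B) \<in> \<Psi>" and
    s: "s = (insert (At i A j) \<Gamma>, insert (At i B j) \<Delta>) \<or> s = (insert (At i B j) \<Gamma>, insert (At i A j) \<Delta>)"
    unfolding corresponding_sequents_def by blast
  note e = entails[OF this(1), of i j]
  from s show ?case
  proof
    assume "s = (insert (At i A j) \<Gamma>, insert (At i B j) \<Delta>)"
    then show ?thesis by (intro finitely_entailsI[OF _ _ _ _ e(1)]) simp_all
  next
    assume "s = (insert (At i B j) \<Gamma>, insert (At i A j) \<Delta>)"
    then show ?thesis by (intro finitely_entailsI[OF _ _ _ _ e(2)]) simp_all
  qed
next
  case (axiom \<Gamma> \<Delta>)
  then obtain a where "a \<in> \<Gamma>" "a \<in> \<Delta>" by blast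
  then show ?case
    by (intro finitely_entailsI[of "{a}" "{a}"]) (auto simp: entails_def)
next
  case (axiom_id x \<Delta> \<Gamma>)
  then show ?case
    by (intro finitely_entailsI[of "{}" "{At x PId x}"]) (auto simp: entails_def T_PId val_refl)
next
  case (cut \<Gamma> x A y \<Delta> \<Gamma>' \<Delta>')
  then show ?case
    using finitely_entails_two[of "{}" \<Gamma> "{At x A y}" \<Delta> "{At x A y}" \<Gamma>' "{}" \<Delta>' "{}" "{}"] by auto
next
  case (equality x A y \<Gamma> \<Delta> z)
  then show ?case
    using finitely_entails_one[of "{At x A y}" \<Gamma> "{}" \<Delta> "{At x A z, At z PId y}" "{}"]
    by (auto simp: entails_def T_PId intro: binary_subst[OF T_binary _ val_refl])
next
  case (plus_left x A y \<Gamma> \<Delta> B \<Gamma>' \<Delta>')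
  then show ?case
    using finitely_entails_two[of "{At x A y}" \<Gamma> "{}" \<Delta> "{At x B y}" \<Gamma>' "{}" \<Delta>' "{At x (PPlus A B) y}" "{}"]
    by (auto simp: val_T)
next
  case (plus_right \<Gamma> x A y B \<Delta>)
  then show ?case
    using finitely_entails_one[of "{}" \<Gamma> "{At x A y, At x B y}" \<Delta> "{}" "{At x (PPlus A B) y}"]
    by (auto simp: val_T entails_def)
next
  case (compl_left \<Gamma> x A y \<Delta>)
  then show ?case
    using finitely_entails_one[of "{}" \<Gamma> "{At x A y}" \<Delta> "{At x (PCompl A) y}" "{}"]
    by (auto simp: val_T entails_def)
next
  case (compl_right x A y \<Gamma> \<Delta>)
  then show ?case
    using finitely_entails_one[of "{At x A y}" \<Gamma> "{}" \<Delta> "{}" "{At x (PCompl A) y}"]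
    by (auto simp: val_T entails_def)
next
  case (comp_left x A y B z \<Gamma> \<Delta>)
  have "finitely_entails ({At x (PComp A B) z} \<union> \<Gamma>) ({} \<union> \<Delta>)"
  proof (rule finitely_entails_one)
    show "finitely_entails ({At x A y, At y B z} \<union> \<Gamma>) ({} \<union> \<Delta>)"
      using comp_left.IH by simp
    fix \<Gamma>\<^sub>0 \<Delta>\<^sub>0
    assume "finite \<Gamma>\<^sub>0" "finite \<Delta>\<^sub>0" "\<Gamma>\<^sub>0 \<subseteq> \<Gamma>" "\<Delta>\<^sub>0 \<subseteq> \<Delta>"
      "entails ({At x A y, At y B z} \<union> \<Gamma>\<^sub>0) ({} \<union> \<Delta>\<^sub>0)"
    then show "entails ({At x (PComp A B) z} \<union> \<Gamma>\<^sub>0) ({} \<union> \<Delta>\<^sub>0)"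
      using entails_comp_left[of \<Gamma>\<^sub>0 \<Delta>\<^sub>0 x A y B z] comp_left.hyps by auto
  qed simp_all
  then show ?case by simp
next
  case (comp_right \<Gamma> x A y \<Delta> \<Gamma>' B z \<Delta>')
  then show ?case
    using finitely_entails_two[of "{}" \<Gamma> "{At x A y}" \<Delta> "{}" \<Gamma>' "{At y B z}" \<Delta>' "{}" "{At x (PComp A B) z}"]
    by (auto dest: val_T_compI)
next
  case (conv_left x A y \<Gamma> \<Delta>)
  then show ?case
    using finitely_entails_one[of "{At x A y}" \<Gamma> "{}" \<Delta> "{At y (PConv A) x}" "{}"]
    by (auto simp: val_T entails_def)
next
  case (conv_right \<Gamma> x A y \<Delta>)
  then show ?case
    using finitely_entails_one[of "{}" \<Gamma> "{At x A y}" \<Delta> "{}" "{At y (PConv A) x}"]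
    by (auto simp: val_T entails_def)
qed

lemma D_if_omega_provable:
  assumes "\<And>A B. (A \<doteq> B) \<in> \<Psi> \<Longrightarrow> D (T A 0 1 \<^bold>\<longleftrightarrow> T B 0 1)"
    and "({}, {At x A y}) \<in> omega_provable (corresponding_sequents \<Psi>)"
  shows "D (T A x y)"
proof (rule tautological_consequence)
  fix v assume v: "valuation v"
  have "finitely_entails {} {At x A y}"
    using omega_provable_entails[OF assms] by simp
  then obtain \<Delta>\<^sub>0 where "\<Delta>\<^sub>0 \<subseteq> {At x A y}" "entails {} \<Delta>\<^sub>0"
    unfolding finitely_entails_def by auto
  with v show "v (T A x y)"
    unfolding entails_def by fastforce
qed (rule T_F)

end

section \<open>Derivations in the two first-order formalisms\<close>

lemma (in hilbert) pr_closure_if_D: "D \<phi> \<Longrightarrow> pr (univ_closure \<phi>)"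
  unfolding univ_closure_def by (simp add: D_def finite_fvars)

lemma hilbert_Lplus: "hilbert UNIV (logical_axioms formulas_Lplus \<union> definitional_axioms \<union> X)"
  by unfold_locales (auto simp: formulas_Lplus_def)

text \<open>The definitional axiom for equations unpacks the hypotheses and packs the conclusion. In
  between, \<open>v0 A v0\<close> together with \<open>v0 = v1\<close> gives \<open>v0 A v1\<close>,
  so the identity can be absorbed into \<open>A\<close>.\<close>

lemma provable_Lplus_if_omega_provable:
  assumes "({}, {At 0 A 0}) \<in> omega_provable (corresponding_sequents \<Psi>)"
  shows "FEqn ` \<Psi> \<turnstile>\<^sup>+ FEqn (pred_le PId A)"
proof -
  let ?S = "logical_axioms formulas_Lplus \<union> definitional_axioms \<union> FEqn ` \<Psi>"
  let ?R = "\<lambda>A x y. FRel x A y"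
  interpret hilbert UNIV ?S by (rule hilbert_Lplus)
  have ax: "D \<alpha>" if "univ_closure \<alpha> \<in> definitional_axioms" for \<alpha>
    using that by (intro D_if_closure mp_derivable.intros) simp_all
  have bin: "binary (?R A)" for A
    by (rule binary_atom) simp
  \<comment> \<open>The variable bound in the definitional axiom for relative products is the one
    that the clause \<open>T_comp\<close> prescribes for the arguments 0 and 1.\<close>
  have two: "(LEAST z::nat. z \<noteq> 0 \<and> z \<noteq> 1) = 2"
    by (rule Least_equality) auto
  interpret atom_translation UNIV ?S ?R
  proof
    show "binary (?R A)" for A by (rule bin)
    show "D (?R (PPlus A B) x y \<^bold>\<longleftrightarrow> ?R A x y \<^bold>\<or> ?R B x y)" for A B x y
      by (rule D_binary_generalize[OF binary_iff[OF bin binary_or[OF bin bin]] zero_neq_one])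
        (intro ax definitional_axioms.intros)
    show "D (?R (PCompl A) x y \<^bold>\<longleftrightarrow> FNot (?R A x y))" for A x y
      by (rule D_binary_generalize[OF binary_iff[OF bin binary_not[OF bin]] zero_neq_one])
        (intro ax definitional_axioms.intros)
    show "D (?R (PConv A) x y \<^bold>\<longleftrightarrow> ?R A y x)" for A x y
      by (rule D_binary_generalize[OF binary_iff[OF bin binary_converse[OF bin]] zero_neq_one])
        (intro ax definitional_axioms.intros)
    have "binary (\<lambda>x y. fcomp (?R A) (?R B) (LEAST z. z \<noteq> x \<and> z \<noteq> y) x y)" for A B
      by (rule binary_fcomp[OF bin bin]) (simp add: least_other)
    note comp = binary_iff[OF bin this]
    have def: "univ_closure (?R (PComp A B) 0 1 \<^bold>\<longleftrightarrow> fcomp (?R A) (?R B) (LEAST z. z \<noteq> 0 \<and> z \<noteq> 1) 0 1)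
        \<in> definitional_axioms" for A B
      unfolding two fcomp_def by (rule definitional_axioms.intros)
    show "D (?R (PComp A B) x y \<^bold>\<longleftrightarrow> fcomp (?R A) (?R B) (LEAST z. z \<noteq> x \<and> z \<noteq> y) x y)" for A B x y
      by (rule D_binary_generalize[OF comp zero_neq_one ax[OF def]])
  qed simp
  \<comment> \<open>\<open>ax\<close> expects a universal closure; this axiom is a sentence and
    hence its own closure.\<close>
  have eqn: "D (FEqn (A \<doteq> B) \<^bold>\<longleftrightarrow> univ_closure (?R A 0 1 \<^bold>\<longleftrightarrow> ?R B 0 1))" for A B
    by (intro ax) (subst univ_closure_sentence, simp, rule definitional_axioms.intros(5))
  have "D (?R A 0 1 \<^bold>\<longleftrightarrow> ?R B 0 1)" if "(A \<doteq> B) \<in> \<Psi>" for A B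
  proof -
    have "D (FEqn (A \<doteq> B))"
      by (rule D_if_pr_sentence) (use that in \<open>auto intro: mp_derivable.intros\<close>)
    then have "D (univ_closure (?R A 0 1 \<^bold>\<longleftrightarrow> ?R B 0 1))"
    proof (intro tautological_consequence)
      fix v assume v: "valuation v"
      then show "v (univ_closure (?R A 0 1 \<^bold>\<longleftrightarrow> ?R B 0 1))"
        using valuation_D[OF v eqn, of A B] valuation_D[OF v \<open>D (FEqn (A \<doteq> B))\<close>]
        by (simp add: valuation_simps[OF v])
    qed simp
    then show ?thesis
      by (intro D_if_closure) (simp_all add: pr_if_D)
  qed
  then have "D (?R A 0 0)"
    using assms by (rule D_if_omega_provable)
  have "D (?R (PPlus PId A) 0 1 \<^bold>\<longleftrightarrow> ?R A 0 1)"
  proof (rule tautological_consequence)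
    fix v assume v: "valuation v"
    have "v (FEq 0 1) \<Longrightarrow> v (?R A 0 1)"
      using binary_subst[OF bin v val_refl[OF v] _ valuation_D[OF v \<open>D (?R A 0 0)\<close>]] .
    then show "v (?R (PPlus PId A) 0 1 \<^bold>\<longleftrightarrow> ?R A 0 1)"
      using val_T(1)[OF v, where A = PId and B = A and x = 0 and y = 1] by (auto simp: valuation_simps[OF v])
  qed simp
  then have closure: "D (univ_closure (?R (PPlus PId A) 0 1 \<^bold>\<longleftrightarrow> ?R A 0 1))"
    by (rule D_if_pr_sentence[OF _ _ pr_closure_if_D, rotated 2]) simp_all
  have "D (FEqn (PPlus PId A \<doteq> A))"
  proof (rule tautological_consequence)
    fix v assume v: "valuation v"
    show "v (FEqn (PPlus PId A \<doteq> A))"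
      using valuation_D[OF v eqn, of "PPlus PId A" A] valuation_D[OF v closure]
      by (simp add: valuation_simps[OF v])
  qed simp
  then show ?thesis
    unfolding provable_Lplus_def pred_le_def by (rule pr_if_D) simp
qed

lemma formulas_L_simps:
  "FRel x A y \<in> formulas_L \<longleftrightarrow> A \<in> relation_symbols"
  "(\<phi> \<^bold>\<Rightarrow> \<psi>) \<in> formulas_L \<longleftrightarrow> \<phi> \<in> formulas_L \<and> \<psi> \<in> formulas_L"
  "FNot \<phi> \<in> formulas_L \<longleftrightarrow> \<phi> \<in> formulas_L"
  "FAll x \<phi> \<in> formulas_L \<longleftrightarrow> \<phi> \<in> formulas_L"
  by (auto intro: formulas_L.intros elim: formulas_L.cases)

lemma hilbert_L: "hilbert formulas_L (logical_axioms formulas_L \<union> X)"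
  by unfold_locales (auto simp: formulas_L_simps relation_symbols_def)

text \<open>The clauses for the operators hold by definition of \<open>G_rel\<close>; what takes an
  induction is that \<open>G_rel A x y\<close> respects equality. At a relative product the bound
  variable changes with \<open>x\<close> and \<open>y\<close>, which is the situation of
  \<open>binary_fcomp\<close>.\<close>

lemma provable_L_if_omega_provable:
  fixes \<Psi> :: "'p equation set"
  assumes "({}, {At 0 A 0}) \<in> omega_provable (corresponding_sequents \<Psi>)"
  shows "(G \<circ> FEqn) ` \<Psi> \<turnstile> FAll 0 (G (FRel 0 A 0))"
proof -
  define S where "S = logical_axioms formulas_L \<union> (G \<circ> FEqn) ` \<Psi>"
  interpret hilbert formulas_L S unfolding S_def by (rule hilbert_L)
  have comp: "G_rel (PComp A B) = (\<lambda>x y. fcomp (G_rel A) (G_rel B) (LEAST z. z \<noteq> x \<and> z \<noteq> y) x y)" for A B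
    by (intro ext) (simp add: fcomp_def Let_def)
  have unfold_G: "G_rel (PVar p) = (\<lambda>x y. FRel x (PVar p) y)" "G_rel PId = (\<lambda>x y. FEq x y)"
    "G_rel (PPlus A B) = (\<lambda>x y. G_rel A x y \<^bold>\<or> G_rel B x y)"
    "G_rel (PCompl A) = (\<lambda>x y. FNot (G_rel A x y))"
    "G_rel (PConv A) = (\<lambda>x y. G_rel A y x)" for p :: 'p and A B :: "'p predicate"
    by (intro ext; simp)+
  have bin: "binary (G_rel A)" for A
  proof (induction A)
    case (PVar p)
    show ?case
      unfolding unfold_G by (rule binary_atom) (simp add: formulas_L_simps relation_symbols_def)
  next
    case PId
    show ?case
      unfolding unfold_G by (rule binary_atom) (rule F_eq)
  next
    case (PPlus A B)
    show ?case
      unfolding unfold_G by (rule binary_or[OF PPlus.IH])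
  next
    case (PCompl A)
    show ?case
      unfolding unfold_G by (rule binary_not[OF PCompl.IH])
  next
    case (PComp A B)
    show ?case
      unfolding comp by (rule binary_fcomp[OF PComp.IH]) (simp add: least_other)
  next
    case (PConv A)
    show ?case
      unfolding unfold_G by (rule binary_converse[OF PConv.IH])
  qed
  have refl: "D (\<phi> \<^bold>\<longleftrightarrow> \<phi>)" if "\<phi> \<in> formulas_L" for \<phi>
    by (rule tautological_consequence) (use that in \<open>auto simp: valuation_simps F_simps\<close>)
  interpret atom_translation formulas_L S G_rel
  proof
    show "D (G_rel (PComp A B) x y \<^bold>\<longleftrightarrow> fcomp (G_rel A) (G_rel B) (LEAST z. z \<noteq> x \<and> z \<noteq> y) x y)" for A B x y
      unfolding comp by (rule refl[OF fcomp_F[OF bin bin]])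
  qed (simp_all add: bin binary_F[OF bin] refl F_simps)
  have "D (G_rel A 0 1 \<^bold>\<longleftrightarrow> G_rel B 0 1)" if "(A \<doteq> B) \<in> \<Psi>" for A B
  proof -
    have "G_eqn (A \<doteq> B) \<in> S"
      unfolding S_def using imageI[OF that, of "G \<circ> FEqn"] by simp
    then show ?thesis
      by (intro D_if_closure) (auto simp: F_simps T_F intro: mp_derivable.intros)
  qed
  then have "D (FAll 0 (G_rel A 0 0))"
    using assms by (intro D_gen) (rule D_if_omega_provable)
  then show ?thesis
    unfolding provable_L_def S_def[symmetric] using binary_fvars[OF bin, of A 0 0] by (simp add: pr_if_D)
qed

section \<open>Soundness\<close>


text \<open>An equation is read as equality of the two relations. This agrees with its definitional
  axiom as soon as all values of \<open>I\<close> are relations on \<open>C\<close>, the range of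
  the quantifiers.\<close>

primrec sat :: "'u set \<Rightarrow> ('p predicate \<Rightarrow> ('u \<times> 'u) set) \<Rightarrow> (nat \<Rightarrow> 'u) \<Rightarrow> 'p form \<Rightarrow> bool" where
  "sat C I e (FAtom a) = (case a of At x A y \<Rightarrow> (e x, e y) \<in> I A)"
| "sat C I e (FEqn q) = (case q of (A \<doteq> B) \<Rightarrow> I A = I B)"
| "sat C I e (\<phi> \<^bold>\<Rightarrow> \<psi>) = (sat C I e \<phi> \<longrightarrow> sat C I e \<psi>)"
| "sat C I e (FNot \<phi>) = (\<not> sat C I e \<phi>)"
| "sat C I e (FAll x \<phi>) = (\<forall>u\<in>C. sat C I (e(x := u)) \<phi>)"

lemma sat_connectives [simp]:
  "sat C I e (\<phi> \<^bold>\<or> \<psi>) = (sat C I e \<phi> \<or> sat C I e \<psi>)"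
  "sat C I e (\<phi> \<^bold>\<and> \<psi>) = (sat C I e \<phi> \<and> sat C I e \<psi>)"
  "sat C I e (\<phi> \<^bold>\<longleftrightarrow> \<psi>) = (sat C I e \<phi> \<longleftrightarrow> sat C I e \<psi>)"
  "sat C I e (FEx x \<phi>) = (\<exists>u\<in>C. sat C I (e(x := u)) \<phi>)"
  by (auto simp: FOr_def FAnd_def FIff_def FEx_def)

lemma sat_cong: "(\<And>x. x \<in> fvars \<phi> \<Longrightarrow> e x = e' x) \<Longrightarrow> sat C I e \<phi> = sat C I e' \<phi>"
proof (induction \<phi> arbitrary: e e')
  case (FAtom a)
  then show ?case by (cases a) simp
next
  case (FImp \<phi> \<psi>)
  then show ?case by (metis UnCI fvars.simps(3) sat.simps(3))
next
  case (FAll x \<phi>)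
  have "sat C I (e(x := u)) \<phi> = sat C I (e'(x := u)) \<phi>" for u
    by (rule FAll.IH) (use FAll.prems in auto)
  then show ?case by simp
next
  case (FNot \<phi>)
  then show ?case by (metis fvars.simps(4) sat.simps(4))
qed simp

lemma sat_alls:
  "range e \<subseteq> C \<Longrightarrow> sat C I e (alls xs \<phi>) \<longleftrightarrow>
    (\<forall>e'. range e' \<subseteq> C \<longrightarrow> (\<forall>x. x \<notin> set xs \<longrightarrow> e' x = e x) \<longrightarrow> sat C I e' \<phi>)"
proof (induction xs arbitrary: e)
  case Nil
  then show ?case by (auto simp flip: fun_eq_iff)
next
  case (Cons x xs)
  have "sat C I e (alls (x # xs) \<phi>) \<longleftrightarrow> (\<forall>u\<in>C. \<forall>e'. range e' \<subseteq> C \<longrightarrow>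
      (\<forall>y. y \<notin> set xs \<longrightarrow> e' y = (e(x := u)) y) \<longrightarrow> sat C I e' \<phi>)" (is "_ \<longleftrightarrow> ?R")
  proof -
    have "range (e(x := u)) \<subseteq> C" if "u \<in> C" for u
      using Cons.prems that by auto
    then show ?thesis using Cons.IH by simp
  qed
  also have "?R \<longleftrightarrow> (\<forall>e'. range e' \<subseteq> C \<longrightarrow> (\<forall>y. y \<notin> set (x # xs) \<longrightarrow> e' y = e y) \<longrightarrow> sat C I e' \<phi>)"
  proof (intro iffI allI impI ballI)
    fix e' assume R: ?R and e': "range e' \<subseteq> C" "\<forall>y. y \<notin> set (x # xs) \<longrightarrow> e' y = e y"
    have "(if x \<in> set xs then e x else e' x) \<in> C"
      using Cons.prems e'(1) by auto
    moreover have "e' y = (e(x := if x \<in> set xs then e x else e' x)) y" if "y \<notin> set xs" for y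
      using that e'(2) by auto
    ultimately show "sat C I e' \<phi>" using R e'(1) by blast
  next
    fix u e' assume "\<forall>e'. range e' \<subseteq> C \<longrightarrow> (\<forall>y. y \<notin> set (x # xs) \<longrightarrow> e' y = e y) \<longrightarrow> sat C I e' \<phi>"
      and "range e' \<subseteq> C" "\<forall>y. y \<notin> set xs \<longrightarrow> e' y = (e(x := u)) y"
    then show "sat C I e' \<phi>" by simp
  qed
  finally show ?case .
qed

lemma sat_univ_closure:
  fixes e :: "nat \<Rightarrow> 'u"
  assumes "range e \<subseteq> C"
  shows "sat C I e (univ_closure \<phi>) \<longleftrightarrow> (\<forall>e'. range e' \<subseteq> C \<longrightarrow> sat C I e' \<phi>)"
proof
  assume *: "sat C I e (univ_closure \<phi>)"
  show "\<forall>e'. range e' \<subseteq> C \<longrightarrow> sat C I e' \<phi>"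
  proof (intro allI impI)
    fix e' :: "nat \<Rightarrow> 'u" assume e': "range e' \<subseteq> C"
    \<comment> \<open>The closure lets only free variables of \<open>\<phi>\<close> change, so
      \<open>e'\<close> is used on these and \<open>e\<close> elsewhere; \<open>\<phi>\<close>
      cannot tell \<open>d\<close> from \<open>e'\<close>.\<close>
    define d where "d = (\<lambda>x. if x \<in> fvars \<phi> then e' x else e x)"
    have "range d \<subseteq> C" using assms e' by (auto simp: d_def)
    then have "sat C I d \<phi>"
      using * unfolding univ_closure_def sat_alls[OF assms]
      by (simp add: finite_fvars d_def)
    then show "sat C I e' \<phi>"
      using sat_cong[of \<phi> d e'] by (simp add: d_def)
  qed
qed (simp add: univ_closure_def sat_alls[OF assms])

text \<open>The unit is a full square because first-order negation complements with respect to all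
  pairs of elements.\<close>

locale rel_model =
  fixes C :: "'u set" and I :: "'p predicate \<Rightarrow> ('u \<times> 'u) set"
  assumes nonempty: "C \<noteq> {}"
    and I_subset: "I A \<subseteq> C \<times> C"
    and I_PId: "I PId = Id_on C"
    and I_PPlus: "I (PPlus A B) = I A \<union> I B"
    and I_PCompl: "I (PCompl A) = C \<times> C - I A"
    and I_PComp: "I (PComp A B) = I A O I B"
    and I_PConv: "I (PConv A) = (I A)\<inverse>"
begin

abbreviation valid :: "'p form \<Rightarrow> bool" where
  "valid \<phi> \<equiv> \<forall>e. range e \<subseteq> C \<longrightarrow> sat C I e \<phi>"

lemma valid_univ_closure: "valid \<phi> \<Longrightarrow> valid (univ_closure \<phi>)"
  by (simp add: sat_univ_closure)

lemma valid_logical_axioms: "\<phi> \<in> logical_axioms F \<Longrightarrow> valid \<phi>"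
proof (induction rule: logical_axioms.induct)
  case (4 \<phi> x y)
  show ?case
  proof (intro valid_univ_closure allI impI)
    fix e :: "nat \<Rightarrow> 'u"
    show "sat C I e (FAll x (FAll y \<phi>) \<^bold>\<Rightarrow> FAll y (FAll x \<phi>))"
      by (cases "x = y") (auto simp: fun_upd_twist)
  qed
next
  case (6 \<phi> x)
  show ?case
  proof (intro valid_univ_closure allI impI)
    fix e :: "nat \<Rightarrow> 'u" assume "range e \<subseteq> C"
    then have "e x \<in> C" by blast
    then show "sat C I e (FAll x \<phi> \<^bold>\<Rightarrow> \<phi>)"
      using fun_upd_triv[of e x] by (metis sat.simps(3,5))
  qed
next
  case (7 \<phi> x)
  then have "sat C I (e(x := u)) \<phi> = sat C I e \<phi>" for e u
    by (intro sat_cong) auto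
  then show ?case by (intro valid_univ_closure) simp
next
  case (8 x y)
  then show ?case by (intro valid_univ_closure) (auto simp: I_PId)
next
  case (9 a x y b)
  have "sat C I e (FEq x y \<^bold>\<Rightarrow> (FAtom a \<^bold>\<Rightarrow> FAtom b))" for e
    using 9(2) by cases (auto simp: I_PId)
  then show ?case by (intro valid_univ_closure) blast
qed (intro valid_univ_closure; simp)+

lemma all_pairs_iff:
  "(\<forall>e :: nat \<Rightarrow> 'u. range e \<subseteq> C \<longrightarrow> ((e 0, e 1) \<in> I A \<longleftrightarrow> (e 0, e 1) \<in> I B)) \<longleftrightarrow> I A = I B"
proof (rule iffI, rule set_eqI)
  fix p :: "'u \<times> 'u"
  assume *: "\<forall>e :: nat \<Rightarrow> 'u. range e \<subseteq> C \<longrightarrow> ((e 0, e 1) \<in> I A \<longleftrightarrow> (e 0, e 1) \<in> I B)"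
  obtain a b where p: "p = (a, b)" by (cases p)
  show "p \<in> I A \<longleftrightarrow> p \<in> I B"
  proof (cases "a \<in> C \<and> b \<in> C")
    case True
    then show ?thesis
      using *[rule_format, of "\<lambda>n. if n = 0 then a else b"] by (auto simp: p)
  next
    case False
    then show ?thesis using I_subset p by blast
  qed
qed simp

lemma valid_definitional_axioms: "\<phi> \<in> definitional_axioms \<Longrightarrow> valid \<phi>"
proof (induction rule: definitional_axioms.induct)
  case (2 A)
  then show ?case by (intro valid_univ_closure) (auto simp: I_PCompl)
next
  case (3 A B)
  have "sat C I e (FRel 0 (PComp A B) 1 \<^bold>\<longleftrightarrow> FEx 2 (FRel 0 A 2 \<^bold>\<and> FRel 2 B 1))" for e
    using I_subset[of A] by (auto simp: I_PComp)
  then show ?case by (intro valid_univ_closure) blast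
next
  case (5 A B)
  show ?case
    using all_pairs_iff[of A B] by (simp add: sat_univ_closure)
qed (intro valid_univ_closure; simp add: I_PPlus I_PConv)+

lemma valid_derivable: "mp_derivable X \<phi> \<Longrightarrow> (\<And>\<psi>. \<psi> \<in> X \<Longrightarrow> valid \<psi>) \<Longrightarrow> valid \<phi>"
  by (induction rule: mp_derivable.induct) auto

lemma sat_G_rel:
  "range e \<subseteq> C \<Longrightarrow> sat C I e (G_rel A x y) \<longleftrightarrow> (e x, e y) \<in> I A"
proof (induction A arbitrary: e x y)
  case (PCompl A)
  then show ?case by (auto simp: I_PCompl)
next
  case (PComp A B)
  have *: "range (e(z := u)) \<subseteq> C" if "u \<in> C" for z u
    using that PComp.prems by auto
  have "sat C I e (G_rel (PComp A B) x y) \<longleftrightarrow> (\<exists>u\<in>C. (e x, u) \<in> I A \<and> (u, e y) \<in> I B)"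
    using least_other[of x y] least_other[of x y, symmetric]
    by (auto simp: Let_def PComp.IH[OF *])
  then show ?case using I_subset[of A] by (auto simp: I_PComp)
qed (auto simp: I_PPlus I_PConv)

end

text \<open>The common semantic target: both formalisms are sound for it, it passes to representable
  algebras, and the Henkin model refutes it. The inclusion of the diagonal is what
  \<open>1' \<le> A\<close> says in a square model.\<close>

definition id_consequence :: "'u itself \<Rightarrow> 'p equation set \<Rightarrow> 'p predicate \<Rightarrow> bool" where
  "id_consequence _ \<Psi> A \<longleftrightarrow> (\<forall>(C :: 'u set) I. rel_model C I \<longrightarrow>
     (\<forall>A B. (A \<doteq> B) \<in> \<Psi> \<longrightarrow> I A = I B) \<longrightarrow> Id_on C \<subseteq> I A)"

section \<open>Soundness for square models and for representable algebras\<close>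

lemma id_consequence_if_provable_Lplus:
  assumes "FEqn ` \<Psi> \<turnstile>\<^sup>+ FEqn (pred_le PId A)"
  shows "id_consequence TYPE('u) \<Psi> A"
  unfolding id_consequence_def
proof (intro allI impI)
  fix C :: "'u set" and I
  assume "rel_model C I" and \<Psi>: "\<forall>A B. (A \<doteq> B) \<in> \<Psi> \<longrightarrow> I A = I B"
  then interpret rel_model C I by blast
  have eqns: "valid \<psi>" if "\<psi> \<in> FEqn ` \<Psi>" for \<psi>
    using that \<Psi> by (auto split: equation.split)
  have valid: "valid (FEqn (pred_le PId A))"
  proof (rule valid_derivable[OF assms[unfolded provable_Lplus_def]])
    fix \<psi> assume "\<psi> \<in> logical_axioms formulas_Lplus \<union> definitional_axioms \<union> FEqn ` \<Psi>"
    then show "valid \<psi>"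
      using valid_logical_axioms[of \<psi> formulas_Lplus] valid_definitional_axioms[of \<psi>] eqns[of \<psi>]
      by (elim UnE)
  qed
  obtain c where "c \<in> C" using nonempty by blast
  with valid[rule_format, of "\<lambda>_. c"] have "I (PPlus PId A) = I A"
    by (auto simp: pred_le_def)
  then show "Id_on C \<subseteq> I A" by (auto simp: I_PPlus I_PId)
qed

lemma id_consequence_if_provable_L:
  assumes "(G \<circ> FEqn) ` \<Psi> \<turnstile> FAll 0 (G (FRel 0 A 0))"
  shows "id_consequence TYPE('u) \<Psi> A"
  unfolding id_consequence_def
proof (intro allI impI)
  fix C :: "'u set" and I
  assume "rel_model C I" and \<Psi>: "\<forall>A B. (A \<doteq> B) \<in> \<Psi> \<longrightarrow> I A = I B"
  then interpret rel_model C I by blast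
  have eqns: "valid \<psi>" if "\<psi> \<in> (G \<circ> FEqn) ` \<Psi>" for \<psi>
  proof -
    from that obtain q where "q \<in> \<Psi>" "\<psi> = G_eqn q"
      by auto
    moreover obtain A B where "q = (A \<doteq> B)" by (cases q)
    ultimately have "(A \<doteq> B) \<in> \<Psi>" and \<psi>: "\<psi> = G_eqn (A \<doteq> B)" by simp_all
    with \<Psi> have "I A = I B" by blast
    then show ?thesis by (simp add: \<psi> sat_univ_closure sat_G_rel)
  qed
  have valid: "valid (FAll 0 (G (FRel 0 A 0)))"
  proof (rule valid_derivable[OF assms[unfolded provable_L_def]])
    fix \<psi> assume "\<psi> \<in> logical_axioms formulas_L \<union> (G \<circ> FEqn) ` \<Psi>"
    then show "valid \<psi>"
      using valid_logical_axioms[of \<psi> formulas_L] eqns[of \<psi>] by (elim UnE)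
  qed
  have "(u, u) \<in> I A" if "u \<in> C" for u
    using valid[rule_format, of "\<lambda>_. u"] sat_G_rel[of "(\<lambda>_. u)(0 := u)" A 0 0] that by auto
  then show "Id_on C \<subseteq> I A" by auto
qed

text \<open>The unit \<open>E\<close> is the union of the squares of its classes. Restricting the
  values of the homomorphism to one such square gives a \<open>rel_model\<close>, so every pair
  \<open>(u, u)\<close> in \<open>E\<close> is found in the value of \<open>A\<close>.\<close>

lemma RRA_consequence:
  assumes "id_consequence TYPE('u) \<Psi> A" and "\<AA> \<in> RRA TYPE('u)" and "models_under \<AA> h \<Psi>"
  shows "models_under \<AA> h {pred_le PId A}"
proof -
  have h: "alg_hom predicate_algebra \<AA> h" and \<Psi>: "\<And>A B. (A \<doteq> B) \<in> \<Psi> \<Longrightarrow> h A = h B"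
    using assms(3) by (auto simp: models_under_def)
  obtain \<BB> :: "('u \<times> 'u) set rel_alg" and f where \<BB>: "proper_rel_alg \<BB>"
    and f: "alg_hom \<AA> \<BB> f" and bij: "bij_betw f (carr \<AA>) (carr \<BB>)"
    using assms(2) unfolding RRA_def alg_iso_def by blast
  obtain E where "E \<in> carr \<BB>" and E: "equiv (Field E) E"
    and sub: "\<forall>X\<in>carr \<BB>. X \<subseteq> E"
    and ops: "\<forall>X\<in>carr \<BB>. \<forall>Y\<in>carr \<BB>. aplus \<BB> X Y = X \<union> Y"
      "\<forall>X\<in>carr \<BB>. acompl \<BB> X = E - X"
      "\<forall>X\<in>carr \<BB>. \<forall>Y\<in>carr \<BB>.
         acomp \<BB> X Y = {(x, y). \<exists>z. (x, z) \<in> X \<and> (z, y) \<in> Y}"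
      "\<forall>X\<in>carr \<BB>. aconv \<BB> X = {(x, y). (y, x) \<in> X}"
      "aid \<BB> = {(x, x) | x. (x, x) \<in> E}"
    using \<BB> unfolding proper_rel_alg_def by (elim conjE bexE) (rule that; assumption)
  have h_carr: "h B \<in> carr \<AA>" for B
    using h by (simp add: alg_hom_def predicate_algebra_def)
  define k where "k = f \<circ> h"
  have k_carr: "k B \<in> carr \<BB>" for B
    using f h_carr by (simp add: alg_hom_def k_def)
  have k: "k (PPlus B B') = k B \<union> k B'" "k (PCompl B) = E - k B" "k (PComp B B') = k B O k B'"
    "k (PConv B) = (k B)\<inverse>" "k PId = {(x, x) | x. (x, x) \<in> E}" for B B'
  proof -
    have "k (PPlus B B') = aplus \<BB> (k B) (k B')" "k (PCompl B) = acompl \<BB> (k B)"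
      "k (PComp B B') = acomp \<BB> (k B) (k B')" "k (PConv B) = aconv \<BB> (k B)" "k PId = aid \<BB>"
      using h f h_carr by (simp_all add: alg_hom_def predicate_algebra_def k_def)
    then show "k (PPlus B B') = k B \<union> k B'" "k (PCompl B) = E - k B" "k (PComp B B') = k B O k B'"
      "k (PConv B) = (k B)\<inverse>" "k PId = {(x, x) | x. (x, x) \<in> E}"
      by (auto simp: ops k_carr)
  qed
  have k_sub: "k B \<subseteq> E" for B
    using sub k_carr by blast
  have "(u, u) \<in> k A" if u: "(u, u) \<in> E" for u
  proof -
    define C where "C = E `` {u}"
    have symE: "(y, x) \<in> E" if "(x, y) \<in> E" for x y
      using E that by (meson equivE symE)
    have transE: "(x, z) \<in> E" if "(x, y) \<in> E" "(y, z) \<in> E" for x y z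
      using E that by (meson equivE transE)
    have CE: "C \<times> C \<subseteq> E"
      using symE transE unfolding C_def by blast
    have EC: "y \<in> C" if "(x, y) \<in> E" "x \<in> C" for x y
      using transE that unfolding C_def by blast
    have "rel_model C (\<lambda>B. k B \<inter> C \<times> C)"
    proof
      show "C \<noteq> {}" using u by (auto simp: C_def)
    next
      \<comment> \<open>An intermediate point of a composition starting in \<open>C\<close> is in
        \<open>C\<close> again, because the relations are included in \<open>E\<close>.\<close>
      fix B B'
      show "k (PComp B B') \<inter> C \<times> C = (k B \<inter> C \<times> C) O (k B' \<inter> C \<times> C)"
        using EC k_sub[of B] unfolding k by blast
    qed (use CE in \<open>auto simp: k\<close>)
    moreover have "\<forall>B B'. (B \<doteq> B') \<in> \<Psi> \<longrightarrow> k B \<inter> C \<times> C = k B' \<inter> C \<times> C"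
      by (auto simp: k_def dest: \<Psi>)
    ultimately have "Id_on C \<subseteq> k A \<inter> C \<times> C"
      using assms(1) unfolding id_consequence_def by blast
    then show ?thesis using u by (auto simp: C_def)
  qed
  then have "k (PPlus PId A) = k A"
    by (auto simp: k)
  \<comment> \<open>The isomorphism is injective on the carrier, so the equation is pulled back from
    the proper algebra.\<close>
  then have "h (PPlus PId A) = h A"
    using bij h_carr by (auto simp: k_def bij_betw_def dest: inj_onD)
  then show ?thesis
    using h by (simp add: models_under_def pred_le_def)
qed

section \<open>Completeness of the sequent calculus\<close>

text \<open>Weakening is obtained as a cut against an axiom that carries the larger context. The cut
  formula is an atom of the given sequent, whence the condition that there is one.\<close>

lemma omega_provable_weaken:
  assumes "(\<Gamma>, \<Delta>) \<in> omega_provable \<Theta>" "\<Gamma> \<union> \<Delta> \<noteq> {}" "\<Gamma> \<subseteq> \<Gamma>'" "\<Delta> \<subseteq> \<Delta>'"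
  shows "(\<Gamma>', \<Delta>') \<in> omega_provable \<Theta>"
proof -
  from assms(2) obtain x A y where "At x A y \<in> \<Gamma> \<or> At x A y \<in> \<Delta>"
    by (metis UnE atom.exhaust ex_in_conv)
  then show ?thesis
  proof
    assume a: "At x A y \<in> \<Gamma>"
    have "(\<Gamma>', insert (At x A y) \<Delta>') \<in> omega_provable \<Theta>"
      by (rule omega_provable.axiom) (use a assms(3) in blast)
    moreover have "(insert (At x A y) \<Gamma>, \<Delta>) \<in> omega_provable \<Theta>"
      using assms(1) a by (simp add: insert_absorb)
    ultimately have "(\<Gamma>' \<union> \<Gamma>, \<Delta>' \<union> \<Delta>) \<in> omega_provable \<Theta>"
      by (rule omega_provable.cut)
    then show ?thesis using assms(3,4) by (simp add: Un_absorb2)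
  next
    assume a: "At x A y \<in> \<Delta>"
    have "(insert (At x A y) \<Gamma>', \<Delta>') \<in> omega_provable \<Theta>"
      by (rule omega_provable.axiom) (use a assms(4) in blast)
    moreover have "(\<Gamma>, insert (At x A y) \<Delta>) \<in> omega_provable \<Theta>"
      using assms(1) a by (simp add: insert_absorb)
    ultimately have "(\<Gamma> \<union> \<Gamma>', \<Delta> \<union> \<Delta>') \<in> omega_provable \<Theta>"
      by (intro omega_provable.cut)
    then show ?thesis using assms(3,4) by (simp add: Un_absorb1)
  qed
qed

section \<open>Henkin construction on the variables\<close>

lemma finite_atom_vars: "finite (atom_vars a)"
  by (cases a) simp

text \<open>One stage of the construction. By cut, adding \<open>a\<close> on at least one side
  keeps the sequent unprovable. If a relative product goes to the left, the left rule for it permits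
  a witness, and finiteness provides a fresh variable.\<close>

lemma decide_atom:
  fixes a :: "'p atom"
  assumes fin: "finite \<Gamma>" "finite \<Delta>" and unprov: "(\<Gamma>, \<Delta>) \<notin> omega_provable \<Theta>"
  shows "\<exists>\<Gamma>' \<Delta>'. finite \<Gamma>' \<and> finite \<Delta>' \<and> (\<Gamma>', \<Delta>') \<notin> omega_provable \<Theta> \<and> \<Gamma> \<subseteq> \<Gamma>' \<and> \<Delta> \<subseteq> \<Delta>' \<and>
    a \<in> \<Gamma>' \<union> \<Delta>' \<and>
    (\<forall>x A B z. a = At x (PComp A B) z \<longrightarrow> a \<in> \<Gamma>' \<longrightarrow> (\<exists>y. At x A y \<in> \<Gamma>' \<and> At y B z \<in> \<Gamma>'))"
proof (cases "(insert a \<Gamma>, \<Delta>) \<in> omega_provable \<Theta>")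
  case True
  have right: "(\<Gamma>, insert a \<Delta>) \<notin> omega_provable \<Theta>"
  proof
    obtain x A y where a: "a = At x A y" by (cases a)
    assume "(\<Gamma>, insert a \<Delta>) \<in> omega_provable \<Theta>"
    from omega_provable.cut[OF this[unfolded a] True[unfolded a]] unprov show False by simp
  qed
  \<comment> \<open>Hence the witness condition holds vacuously when \<open>a\<close> is put on the
    right.\<close>
  have "a \<notin> \<Gamma>"
    using True unprov by (auto simp: insert_absorb)
  show ?thesis
    by (rule exI[of _ \<Gamma>], rule exI[of _ "insert a \<Delta>"], intro conjI)
      (use fin right \<open>a \<notin> \<Gamma>\<close> in auto)
next
  case False
  show ?thesis
  proof (cases "\<exists>x A B z. a = At x (PComp A B) z")
    case True
    then obtain x A B z where a: "a = At x (PComp A B) z" by blast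
    have "finite (\<Union>b\<in>insert a (\<Gamma> \<union> \<Delta>). atom_vars b)"
      using fin by (simp add: finite_atom_vars)
    then obtain y where y: "y \<notin> (\<Union>b\<in>insert a (\<Gamma> \<union> \<Delta>). atom_vars b)"
      using ex_new_if_finite[OF infinite_UNIV_nat] by blast
    \<comment> \<open>The product \<open>a\<close> stays on the left beside its witness atoms;
      \<open>y\<close> therefore has to avoid the variables of \<open>a\<close> too.\<close>
    let ?\<Gamma> = "insert (At x A y) (insert (At y B z) (insert a \<Gamma>))"
    have left: "(?\<Gamma>, \<Delta>) \<notin> omega_provable \<Theta>"
    proof
      assume "(?\<Gamma>, \<Delta>) \<in> omega_provable \<Theta>"
      then have "(insert (At x (PComp A B) z) (insert a \<Gamma>), \<Delta>) \<in> omega_provable \<Theta>"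
        by (rule omega_provable.comp_left) (use y in \<open>auto simp: a\<close>)
      with False show False by (simp add: a)
    qed
    show ?thesis
    proof (rule exI[of _ ?\<Gamma>], rule exI[of _ \<Delta>], intro conjI)
      show "\<forall>x A B z. a = At x (PComp A B) z \<longrightarrow> a \<in> ?\<Gamma> \<longrightarrow> (\<exists>y. At x A y \<in> ?\<Gamma> \<and> At y B z \<in> ?\<Gamma>)"
        by (intro allI impI exI[of _ y]) (auto simp: a)
    qed (use fin left in auto)
  next
    case no_comp: False
    show ?thesis
      by (rule exI[of _ "insert a \<Gamma>"], rule exI[of _ \<Delta>], intro conjI) (use fin False no_comp in auto)
  qed
qed

text \<open>\<open>M\<close> is the union of the left sides of a growing chain of unprovable
  sequents that decides every atom and keeps \<open>b\<close> on the right. A provable sequent with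
  its left side in \<open>M\<close> and its right side outside would be contained in some stage,
  which would be provable by weakening.\<close>

lemma henkin_set:
  fixes \<Theta> :: "'p sequent set"
  assumes "countable (UNIV :: 'p atom set)" and "({}, {b}) \<notin> omega_provable \<Theta>"
  obtains M where "b \<notin> M"
    "\<And>\<Gamma> \<Delta>. (\<Gamma>, \<Delta>) \<in> omega_provable \<Theta> \<Longrightarrow> finite \<Gamma> \<Longrightarrow> finite \<Delta> \<Longrightarrow> \<Gamma> \<union> \<Delta> \<noteq> {} \<Longrightarrow>
      \<Gamma> \<subseteq> M \<Longrightarrow> \<Delta> \<inter> M \<noteq> {}"
    "\<And>x A B z. At x (PComp A B) z \<in> M \<Longrightarrow> \<exists>y. At x A y \<in> M \<and> At y B z \<in> M"
proof -
  define enum :: "nat \<Rightarrow> 'p atom" where "enum = from_nat_into UNIV"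
  define P :: "nat \<Rightarrow> 'p sequent \<Rightarrow> bool"
    where "P n s \<longleftrightarrow> finite (fst s) \<and> finite (snd s) \<and> b \<in> snd s \<and> s \<notin> omega_provable \<Theta>" for n s
  define Q :: "nat \<Rightarrow> 'p sequent \<Rightarrow> 'p sequent \<Rightarrow> bool"
    where "Q n s t \<longleftrightarrow> fst s \<subseteq> fst t \<and> snd s \<subseteq> snd t \<and> enum n \<in> fst t \<union> snd t \<and>
      (\<forall>x A B z. enum n = At x (PComp A B) z \<longrightarrow> enum n \<in> fst t \<longrightarrow>
        (\<exists>y. At x A y \<in> fst t \<and> At y B z \<in> fst t))" for n s t
  have "\<exists>f. \<forall>n. P n (f n) \<and> Q n (f n) (f (Suc n))"
  proof (rule dependent_nat_choice)
    show "\<exists>s. P 0 s" using assms(2) by (intro exI[of _ "({}, {b})"]) (simp add: P_def)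
    fix s n assume s: "P n s"
    then obtain \<Gamma> \<Delta> where *: "finite \<Gamma>" "finite \<Delta>" "(\<Gamma>, \<Delta>) \<notin> omega_provable \<Theta>"
      "fst s \<subseteq> \<Gamma>" "snd s \<subseteq> \<Delta>" "enum n \<in> \<Gamma> \<union> \<Delta>"
      "\<forall>x A B z. enum n = At x (PComp A B) z \<longrightarrow> enum n \<in> \<Gamma> \<longrightarrow> (\<exists>y. At x A y \<in> \<Gamma> \<and> At y B z \<in> \<Gamma>)"
      using decide_atom[of "fst s" "snd s" \<Theta> "enum n"] unfolding P_def prod.collapse by blast
    then have "P (Suc n) (\<Gamma>, \<Delta>)" "Q n s (\<Gamma>, \<Delta>)"
      using s unfolding P_def Q_def fst_conv snd_conv by blast+
    then show "\<exists>t. P (Suc n) t \<and> Q n s t" by blast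
  qed
  then obtain f where P: "\<And>n. P n (f n)" and Q: "\<And>n. Q n (f n) (f (Suc n))" by blast
  have mono: "fst (f m) \<subseteq> fst (f n)" "snd (f m) \<subseteq> snd (f n)" if "m \<le> n" for m n
    using lift_Suc_mono_le[of "\<lambda>n. fst (f n)" m n] lift_Suc_mono_le[of "\<lambda>n. snd (f n)" m n] Q that
    unfolding Q_def by auto
  define M where "M = (\<Union>n. fst (f n))"
  have surj: "\<exists>n. enum n = a" for a
    unfolding enum_def using from_nat_into_surj[OF assms(1), of a] by blast
  have absorbed: "\<exists>n. X \<subseteq> g n"
    if "finite X" "X \<subseteq> (\<Union>n. g n)" "\<And>m n. m \<le> n \<Longrightarrow> g m \<subseteq> g n" for X :: "'p atom set" and g :: "nat \<Rightarrow> _"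
    using that(1,2)
  proof (induction X rule: finite_induct)
    case (insert a X)
    then obtain m n where "a \<in> g m" "X \<subseteq> g n" by auto
    then have "insert a X \<subseteq> g (max m n)"
      using that(3)[of m "max m n"] that(3)[of n "max m n"] by auto
    then show ?case by blast
  qed simp
  have sep: "\<Delta> \<inter> M \<noteq> {}"
    if prov: "(\<Gamma>, \<Delta>) \<in> omega_provable \<Theta>" and fin: "finite \<Gamma>" "finite \<Delta>"
      and ne: "\<Gamma> \<union> \<Delta> \<noteq> {}" and \<Gamma>: "\<Gamma> \<subseteq> M" for \<Gamma> \<Delta>
  proof
    assume "\<Delta> \<inter> M = {}"
    have "\<Delta> \<subseteq> (\<Union>n. snd (f n))"
    proof
      fix a assume "a \<in> \<Delta>"
      obtain n where "enum n = a" using surj by blast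
      then have "a \<in> fst (f (Suc n)) \<union> snd (f (Suc n))"
        using Q[of n] unfolding Q_def by blast
      with \<open>a \<in> \<Delta>\<close> \<open>\<Delta> \<inter> M = {}\<close> show "a \<in> (\<Union>n. snd (f n))"
        unfolding M_def by blast
    qed
    then obtain n where n: "\<Delta> \<subseteq> snd (f n)"
      using absorbed[of \<Delta> "\<lambda>n. snd (f n)"] fin mono by blast
    obtain m where m: "\<Gamma> \<subseteq> fst (f m)"
      using absorbed[of \<Gamma> "\<lambda>n. fst (f n)"] fin mono \<Gamma> unfolding M_def by blast
    have "\<Gamma> \<subseteq> fst (f (max m n))" "\<Delta> \<subseteq> snd (f (max m n))"
      using m n mono(1)[of m "max m n"] mono(2)[of n "max m n"] by auto
    then have "f (max m n) \<in> omega_provable \<Theta>"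
      using omega_provable_weaken[OF prov ne] by (metis prod.collapse)
    then show False using P unfolding P_def by blast
  qed
  show thesis
  proof (rule that)
    show "b \<notin> M"
    proof
      assume "b \<in> M"
      then obtain n where "b \<in> fst (f n)" unfolding M_def by blast
      then have "f n \<in> omega_provable \<Theta>"
        using P[of n] omega_provable.axiom[of "fst (f n)" "snd (f n)"] unfolding P_def by auto
      then show False using P unfolding P_def by blast
    qed
    show "\<exists>y. At x A y \<in> M \<and> At y B z \<in> M" if comp: "At x (PComp A B) z \<in> M" for x A B z
    proof -
      obtain n where n: "enum n = At x (PComp A B) z" using surj by blast
      \<comment> \<open>Were it decided to the right, a later stage would have it on both sides and
        be an axiom.\<close>
      have "enum n \<in> fst (f (Suc n))"
      proof (rule ccontr)
        assume "enum n \<notin> fst (f (Suc n))"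
        then have "enum n \<in> snd (f (Suc n))" using Q[of n] unfolding Q_def by blast
        moreover obtain m where "enum n \<in> fst (f m)" using comp n unfolding M_def by auto
        ultimately have "fst (f (max m (Suc n))) \<inter> snd (f (max m (Suc n))) \<noteq> {}"
          using mono(1)[of m "max m (Suc n)"] mono(2)[of "Suc n" "max m (Suc n)"] by auto
        then have "f (max m (Suc n)) \<in> omega_provable \<Theta>"
          using omega_provable.axiom by (metis prod.collapse)
        then show False using P unfolding P_def by blast
      qed
      then show ?thesis
        using Q[of n] n unfolding Q_def M_def by blast
    qed
  qed (rule sep)
qed

text \<open>\<open>sep\<close>, applied to sequents with very short derivations, shows that
  membership in \<open>M\<close> obeys the clause of each operator; the witnesses for relative
  products come from \<open>wit\<close>. The equations of \<open>\<Psi>\<close> hold because their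
  sequents are given, and the element of variable 0 refutes the inclusion.\<close>

lemma not_id_consequence:
  fixes \<Psi> :: "'p equation set"
  assumes "countable (UNIV :: 'p atom set)" and "infinite (UNIV :: 'u set)"
    and "({}, {At 0 A\<^sub>0 0}) \<notin> omega_provable (corresponding_sequents \<Psi>)"
  shows "\<not> id_consequence TYPE('u) \<Psi> A\<^sub>0"
proof -
  let ?\<Theta> = "corresponding_sequents \<Psi>"
  obtain M where b: "At 0 A\<^sub>0 0 \<notin> M"
    and sep: "\<And>\<Gamma> \<Delta>. (\<Gamma>, \<Delta>) \<in> omega_provable ?\<Theta> \<Longrightarrow> finite \<Gamma> \<Longrightarrow> finite \<Delta> \<Longrightarrow> \<Gamma> \<union> \<Delta> \<noteq> {} \<Longrightarrow>
      \<Gamma> \<subseteq> M \<Longrightarrow> \<Delta> \<inter> M \<noteq> {}"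
    and wit: "\<And>x A B z. At x (PComp A B) z \<in> M \<Longrightarrow> \<exists>y. At x A y \<in> M \<and> At y B z \<in> M"
    using henkin_set[OF assms(1,3)] by blast
  have ax: "(insert a \<Gamma>, insert a \<Delta>) \<in> omega_provable ?\<Theta>" for a \<Gamma> \<Delta>
    by (rule omega_provable.axiom) simp
  have plus: "At x (PPlus A B) y \<in> M \<longleftrightarrow> At x A y \<in> M \<or> At x B y \<in> M" for x y A B
  proof -
    have 1: "({At x A y}, {At x (PPlus A B) y}) \<in> omega_provable ?\<Theta>"
      by (intro omega_provable.plus_right omega_provable.axiom) simp
    have 2: "({At x B y}, {At x (PPlus A B) y}) \<in> omega_provable ?\<Theta>"
      by (intro omega_provable.plus_right omega_provable.axiom) simp
    have 3: "({At x (PPlus A B) y}, {At x A y, At x B y}) \<in> omega_provable ?\<Theta>"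
      using omega_provable.plus_left[OF ax[of "At x A y" "{}" "{}"] ax[of "At x B y" "{}" "{}"]]
      by (simp add: insert_commute)
    show ?thesis using sep[OF 1] sep[OF 2] sep[OF 3] by auto
  qed
  have compl: "At x (PCompl A) y \<in> M \<longleftrightarrow> At x A y \<notin> M" for x y A
  proof -
    have 1: "({At x (PCompl A) y, At x A y}, {}) \<in> omega_provable ?\<Theta>"
      by (rule omega_provable.compl_left) (rule ax)
    have 2: "({}, {At x (PCompl A) y, At x A y}) \<in> omega_provable ?\<Theta>"
      by (rule omega_provable.compl_right) (rule ax)
    show ?thesis using sep[OF 1] sep[OF 2] by auto
  qed
  have conv: "At y (PConv A) x \<in> M \<longleftrightarrow> At x A y \<in> M" for x y A
  proof -
    have 1: "({At y (PConv A) x}, {At x A y}) \<in> omega_provable ?\<Theta>"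
      by (rule omega_provable.conv_left) (rule ax)
    have 2: "({At x A y}, {At y (PConv A) x}) \<in> omega_provable ?\<Theta>"
      by (rule omega_provable.conv_right) (rule ax)
    show ?thesis using sep[OF 1] sep[OF 2] by auto
  qed
  have comp: "At x (PComp A B) z \<in> M \<longleftrightarrow> (\<exists>y. At x A y \<in> M \<and> At y B z \<in> M)" for x z A B
  proof
    assume "\<exists>y. At x A y \<in> M \<and> At y B z \<in> M"
    then obtain y where y: "At x A y \<in> M" "At y B z \<in> M" by blast
    have "({At x A y} \<union> {At y B z}, insert (At x (PComp A B) z) ({} \<union> {})) \<in> omega_provable ?\<Theta>"
      by (rule omega_provable.comp_right; rule ax)
    from sep[OF this] y show "At x (PComp A B) z \<in> M" by simp
  qed (rule wit)
  have reflexive: "At x PId x \<in> M" for x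
  proof -
    have "({}, {At x PId x}) \<in> omega_provable ?\<Theta>"
      by (rule omega_provable.axiom_id) simp
    from sep[OF this] show ?thesis by simp
  qed
  have right: "At x A y \<in> M" if "At x A z \<in> M" "At z PId y \<in> M" for x A y z
  proof -
    have "({At x A z, At z PId y}, {At x A y}) \<in> omega_provable ?\<Theta>"
      by (rule omega_provable.equality) (rule ax)
    from sep[OF this] that show ?thesis by simp
  qed
  \<comment> \<open>The equality rule rewrites right arguments only. Passing to the converse
    predicate makes a left argument a right one; reflexivity rewritten in this way is
    symmetry.\<close>
  have sym: "At y PId x \<in> M" if "At x PId y \<in> M" for x y
    using right[of x "PConv PId" x y] reflexive that by (simp add: conv)
  have left: "At y A z \<in> M" if "At x A z \<in> M" "At x PId y \<in> M" for x A y z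
    using right[of z "PConv A" x y] that by (simp add: conv)
  have eqn: "At x A y \<in> M \<longleftrightarrow> At x B y \<in> M" if "(A \<doteq> B) \<in> \<Psi>" for x A B y
  proof -
    have 1: "({At x A y}, {At x B y}) \<in> ?\<Theta>"
      unfolding corresponding_sequents_def
      by (rule UnI1, rule CollectI, intro exI conjI, rule refl, rule that)
    have 2: "({At x B y}, {At x A y}) \<in> ?\<Theta>"
      unfolding corresponding_sequents_def
      by (rule UnI2, rule CollectI, intro exI conjI, rule refl, rule that)
    show ?thesis
      using sep[OF omega_provable.given[OF 1]] sep[OF omega_provable.given[OF 2]] by auto
  qed
  txt \<open>The least element \<open>r x\<close> represents the class of \<open>x\<close> under the congruence that the equality
    atoms of \<open>M\<close> define.\<close>
  define r where "r x = (LEAST y. At x PId y \<in> M)" for x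
  have r: "At x PId (r x) \<in> M" for x
    unfolding r_def using reflexive by (rule LeastI)
  have r_eq: "r x = r y \<longleftrightarrow> At x PId y \<in> M" for x y
  proof
    assume "r x = r y"
    then show "At x PId y \<in> M" using r[of x] sym[OF r[of y]] right by metis
  next
    assume "At x PId y \<in> M"
    then have "At x PId z \<in> M \<longleftrightarrow> At y PId z \<in> M" for z
      using left sym by blast
    then show "r x = r y" by (simp add: r_def)
  qed
  \<comment> \<open>The classes are represented by natural numbers; this injection moves them into
    the base type \<open>'u\<close>.\<close>
  obtain f :: "nat \<Rightarrow> 'u" where f: "inj f"
    using infinite_countable_subset[OF assms(2)] by blast
  define u where "u x = f (r x)" for x
  have u_eq: "u x = u y \<longleftrightarrow> At x PId y \<in> M" for x y
    using f by (simp add: u_def inj_eq r_eq)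
  define k where "k A = {(u x, u y) | x y. At x A y \<in> M}" for A
  have k_iff: "(u x, u y) \<in> k A \<longleftrightarrow> At x A y \<in> M" for x y A
  proof
    assume "(u x, u y) \<in> k A"
    then obtain x' y' where "u x' = u x" "u y' = u y" "At x' A y' \<in> M"
      unfolding k_def by auto
    then show "At x A y \<in> M"
      using left[of x' A y' x] right[of x A y' y] by (simp add: u_eq)
  qed (auto simp: k_def)
  have k_sub: "k A \<subseteq> range u \<times> range u" for A
    unfolding k_def by blast
  have kI: "X = Y" if "X \<subseteq> range u \<times> range u" "Y \<subseteq> range u \<times> range u"
    "\<And>x y. (u x, u y) \<in> X \<longleftrightarrow> (u x, u y) \<in> Y" for X Y
    using that by blast
  have "rel_model (range u) k"
  proof
    show "k PId = Id_on (range u)"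
      by (rule kI) (use k_sub in \<open>auto simp: k_iff u_eq Id_on_iff\<close>)
    show "k (PPlus A B) = k A \<union> k B" for A B
      by (rule kI) (use k_sub in \<open>auto simp: k_iff plus\<close>)
    show "k (PCompl A) = range u \<times> range u - k A" for A
      by (rule kI) (use k_sub in \<open>auto simp: k_iff compl\<close>)
    show "k (PComp A B) = k A O k B" for A B
    proof (rule kI)
      show "k A O k B \<subseteq> range u \<times> range u" using k_sub by blast
      fix x z
      have "(u x, u z) \<in> k A O k B \<longleftrightarrow> (\<exists>y. (u x, u y) \<in> k A \<and> (u y, u z) \<in> k B)"
        using k_sub by blast
      then show "(u x, u z) \<in> k (PComp A B) \<longleftrightarrow> (u x, u z) \<in> k A O k B"
        by (simp add: k_iff comp)
    qed (rule k_sub)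
    show "k (PConv A) = (k A)\<inverse>" for A
      by (rule kI) (use k_sub in \<open>auto simp: k_iff conv\<close>)
  qed (use k_sub in simp_all)
  moreover have "k A = k B" if "(A \<doteq> B) \<in> \<Psi>" for A B
    by (rule kI[OF k_sub k_sub]) (simp add: k_iff eqn[OF that])
  moreover have "\<not> Id_on (range u) \<subseteq> k A\<^sub>0"
    using b k_iff[of 0 0 A\<^sub>0] by blast
  ultimately show ?thesis
    unfolding id_consequence_def by blast
qed

section \<open>Transport of the countermodel to the given types\<close>

instance predicate :: (countable) countable
  by countable_datatype

instance atom :: (countable) countable
  by countable_datatype

text \<open>Countability of \<open>'p\<close> is a hypothesis and not a class constraint, so the
  class instances are used at \<open>nat\<close> and reached by mapping along an injection.\<close>

lemma countable_atoms:
  assumes "countable (UNIV :: 'p set)"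
  shows "countable (UNIV :: 'p atom set)" and "countable (UNIV :: 'p predicate set)"
proof -
  obtain f :: "'p \<Rightarrow> nat" where f: "inj f"
    using assms unfolding countable_def by blast
  have "inj (to_nat \<circ> map_atom f)" "inj (to_nat \<circ> map_predicate f)"
    using f by (auto intro!: inj_compose simp: atom.inj_map predicate.inj_map)
  then show "countable (UNIV :: 'p atom set)" "countable (UNIV :: 'p predicate set)"
    by (auto intro: countableI)
qed

text \<open>The values of \<open>k\<close> form an algebra of relations, whereas the hypothesis
  concerns algebras on subsets of \<open>'a\<close>. Being countably many, these relations can be
  coded by elements of \<open>'a\<close>, and the operations are transported along the code
  \<open>g\<close>.\<close>

lemma omega_provable_if_RRA_consequence:
  fixes \<Psi> :: "'p equation set"
  assumes "countable (UNIV :: 'p set)" and "infinite (UNIV :: 'a set)" and "infinite (UNIV :: 'u set)"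
    and conseq: "\<And>(\<AA> :: 'a rel_alg) h. \<AA> \<in> RRA TYPE('u) \<Longrightarrow> models_under \<AA> h \<Psi> \<Longrightarrow>
      models_under \<AA> h {pred_le PId A}"
  shows "({}, {At 0 A 0}) \<in> omega_provable (corresponding_sequents \<Psi>)"
proof (rule ccontr)
  assume unprov: "({}, {At 0 A 0}) \<notin> omega_provable (corresponding_sequents \<Psi>)"
  obtain C :: "'u set" and k :: "'p predicate \<Rightarrow> ('u \<times> 'u) set"
    where "rel_model C k" and k_eqn: "\<And>A B. (A \<doteq> B) \<in> \<Psi> \<Longrightarrow> k A = k B"
      and not_id: "\<not> Id_on C \<subseteq> k A"
    using not_id_consequence[OF countable_atoms(1)[OF assms(1)] assms(3) unprov]
    unfolding id_consequence_def by blast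
  interpret rel_model C k by fact
  note k = I_PId I_PPlus I_PCompl I_PComp I_PConv and k_sub = I_subset
  obtain e :: "nat \<Rightarrow> 'a" where e: "inj e"
    using infinite_countable_subset[OF assms(2)] by blast
  have "countable (range k)"
    using countable_atoms(2)[OF assms(1)] by simp
  define g where "g = e \<circ> to_nat_on (range k)"
  have g: "inj_on g (range k)"
    unfolding g_def using \<open>countable (range k)\<close> e
    by (intro comp_inj_on inj_on_to_nat_on) (auto intro: inj_on_subset)
  define g' where "g' = inv_into (range k) g"
  have g'g: "g' (g (k B)) = k B" for B
    unfolding g'_def using g by simp
  define \<BB> :: "('u \<times> 'u) set rel_alg" where
    "\<BB> = \<lparr>carr = range k, aplus = (\<union>), acompl = (\<lambda>X. C \<times> C - X), acomp = (O),
      aconv = converse, aid = Id_on C\<rparr>"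
  define \<AA> :: "'a rel_alg" where
    "\<AA> = \<lparr>carr = range (g \<circ> k), aplus = (\<lambda>a b. g (g' a \<union> g' b)), acompl = (\<lambda>a. g (C \<times> C - g' a)),
      acomp = (\<lambda>a b. g (g' a O g' b)), aconv = (\<lambda>a. g ((g' a)\<inverse>)), aid = g (Id_on C)\<rparr>"
  \<comment> \<open>Read from right to left, the clauses turn an operation on values of
    \<open>k\<close> into the value at a compound predicate. This shows closure of the carriers and
    makes \<open>g'g\<close> applicable.\<close>
  note ops = k[symmetric]
  \<comment> \<open>The unit must belong to the carrier, so it has to be the value of a
    predicate.\<close>
  have "C \<times> C = k (PPlus PId (PCompl PId))"
    using k_sub[of PId] by (auto simp: k)
  then have "C \<times> C \<in> carr \<BB>"
    by (simp add: \<BB>_def)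
  moreover have "equiv (Field (C \<times> C)) (C \<times> C)"
    by (auto simp: equiv_def refl_on_def sym_def trans_def Field_def)
  moreover have "is_algebra \<BB>"
    unfolding is_algebra_def \<BB>_def by (auto simp: ops)
  ultimately have "proper_rel_alg \<BB>"
    unfolding proper_rel_alg_def
    by (intro conjI bexI[of _ "C \<times> C"]) (use k_sub in \<open>auto simp: \<BB>_def\<close>)
  moreover have "is_algebra \<AA>"
    unfolding is_algebra_def \<AA>_def by (auto simp: g'g ops)
  moreover have "alg_hom \<AA> \<BB> g'"
    unfolding alg_hom_def \<AA>_def \<BB>_def by (auto simp: g'g ops)
  moreover have "bij_betw g' (carr \<AA>) (carr \<BB>)"
    unfolding g'_def using bij_betw_inv_into[OF inj_on_imp_bij_betw[OF g]]
    by (simp add: \<AA>_def \<BB>_def image_comp)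
  ultimately have "\<AA> \<in> RRA TYPE('u)"
    unfolding RRA_def alg_iso_def by blast
  moreover have "models_under \<AA> (g \<circ> k) \<Psi>"
    unfolding models_under_def alg_hom_def predicate_algebra_def \<AA>_def
    by (auto simp: g'g k dest: k_eqn)
  ultimately have "models_under \<AA> (g \<circ> k) {pred_le PId A}"
    by (rule conseq)
  then have "g (k (PPlus PId A)) = g (k A)"
    by (simp add: models_under_def pred_le_def)
  then have "k (PPlus PId A) = k A"
    using g'g by metis
  then show False using not_id by (auto simp: k)
qed

theorem theorem19:
  assumes "countable (UNIV :: 'p set)" and "infinite (UNIV :: 'p set)"
    and "infinite (UNIV :: 'a set)" and "infinite (UNIV :: 'u set)"
  shows
    "(\<forall>(\<Psi> :: 'p equation set) (A :: 'p predicate).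
        (A \<in> CT_omega_from \<Psi> \<longleftrightarrow> (FEqn ` \<Psi> \<turnstile>\<^sup>+ FEqn (pred_le PId A))) \<and>
        ((FEqn ` \<Psi> \<turnstile>\<^sup>+ FEqn (pred_le PId A)) \<longleftrightarrow>
          (\<forall>(\<AA> :: 'a rel_alg) h.
             alg_hom predicate_algebra \<AA> h \<and> \<AA> \<in> RRA TYPE('u) \<longrightarrow>
             models_under \<AA> h \<Psi> \<longrightarrow> models_under \<AA> h {pred_le PId A})) \<and>
        ((\<forall>(\<AA> :: 'a rel_alg) h.
             alg_hom predicate_algebra \<AA> h \<and> \<AA> \<in> RRA TYPE('u) \<longrightarrow>
             models_under \<AA> h \<Psi> \<longrightarrow> models_under \<AA> h {pred_le PId A}) \<longleftrightarrow>
          ({}, {At 0 A 0}) \<in> omega_provable (corresponding_sequents \<Psi>)) \<and>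
        (({}, {At 0 A 0}) \<in> omega_provable (corresponding_sequents \<Psi>) \<longleftrightarrow>
          ((G \<circ> FEqn) ` \<Psi> \<turnstile> FAll 0 (G (FRel 0 A 0)))))
     \<and>
     (\<forall>A :: 'p predicate.
        (A \<in> CT_omega \<longleftrightarrow> ({} \<turnstile>\<^sup>+ FEqn (pred_le PId A))) \<and>
        (({} \<turnstile>\<^sup>+ FEqn (pred_le PId A)) \<longleftrightarrow>
          (\<forall>\<AA> \<in> (RRA TYPE('u) :: 'a rel_alg set). true_in \<AA> (pred_le PId A))) \<and>
        ((\<forall>\<AA> \<in> (RRA TYPE('u) :: 'a rel_alg set). true_in \<AA> (pred_le PId A)) \<longleftrightarrow>
          ({}, {At 0 A 0}) \<in> omega_provable {}) \<and>
        (({}, {At 0 A 0}) \<in> omega_provable {} \<longleftrightarrow>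
          ({} \<turnstile> FAll 0 (G (FRel 0 A 0)))))"
proof -
  have RRA_iff: "(\<forall>(\<AA> :: 'a rel_alg) h. alg_hom predicate_algebra \<AA> h \<and> \<AA> \<in> RRA TYPE('u) \<longrightarrow>
      models_under \<AA> h \<Psi> \<longrightarrow> models_under \<AA> h {pred_le PId A}) \<longleftrightarrow>
      ({}, {At 0 A 0}) \<in> omega_provable (corresponding_sequents \<Psi>)"
    and Lplus_iff: "(FEqn ` \<Psi> \<turnstile>\<^sup>+ FEqn (pred_le PId A)) \<longleftrightarrow>
      ({}, {At 0 A 0}) \<in> omega_provable (corresponding_sequents \<Psi>)"
    and L_iff: "((G \<circ> FEqn) ` \<Psi> \<turnstile> FAll 0 (G (FRel 0 A 0))) \<longleftrightarrow>
      ({}, {At 0 A 0}) \<in> omega_provable (corresponding_sequents \<Psi>)"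
    for \<Psi> :: "'p equation set" and A
  proof -
    let ?c = "\<forall>(\<AA> :: 'a rel_alg) h. alg_hom predicate_algebra \<AA> h \<and> \<AA> \<in> RRA TYPE('u) \<longrightarrow>
      models_under \<AA> h \<Psi> \<longrightarrow> models_under \<AA> h {pred_le PId A}"
    let ?d = "({}, {At 0 A 0}) \<in> omega_provable (corresponding_sequents \<Psi>)"
    have cd: ?d if ?c
      using omega_provable_if_RRA_consequence[OF assms(1,3,4), of \<Psi> A] that
      unfolding models_under_def by blast
    have conseq: ?c if "id_consequence TYPE('u) \<Psi> A"
      using RRA_consequence[OF that] by blast
    have b: "FEqn ` \<Psi> \<turnstile>\<^sup>+ FEqn (pred_le PId A)" if ?d
      using that by (rule provable_Lplus_if_omega_provable)
    have e: "(G \<circ> FEqn) ` \<Psi> \<turnstile> FAll 0 (G (FRel 0 A 0))" if ?d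
      using that by (rule provable_L_if_omega_provable)
    have bc: ?c if "FEqn ` \<Psi> \<turnstile>\<^sup>+ FEqn (pred_le PId A)"
      using that by (intro conseq id_consequence_if_provable_Lplus)
    have ec: ?c if "(G \<circ> FEqn) ` \<Psi> \<turnstile> FAll 0 (G (FRel 0 A 0))"
      using that by (intro conseq id_consequence_if_provable_L)
    show "?c \<longleftrightarrow> ?d" using cd b bc by blast
    show "(FEqn ` \<Psi> \<turnstile>\<^sup>+ FEqn (pred_le PId A)) \<longleftrightarrow> ?d" using cd b bc by blast
    show "((G \<circ> FEqn) ` \<Psi> \<turnstile> FAll 0 (G (FRel 0 A 0))) \<longleftrightarrow> ?d" using cd e ec by blast
  qed
  \<comment> \<open>Without equations, \<open>models_under\<close> merely says that \<open>h\<close>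
    is a homomorphism, and there are no corresponding sequents.\<close>
  have true_iff: "(\<forall>\<AA> \<in> (RRA TYPE('u) :: 'a rel_alg set). true_in \<AA> (pred_le PId A)) \<longleftrightarrow>
      ({}, {At 0 A 0}) \<in> omega_provable {}" for A :: "'p predicate"
    using RRA_iff[of "{}" A] by (auto simp: true_in_def models_under_def corresponding_sequents_def)
  have no_sequents: "corresponding_sequents {} = ({} :: 'p sequent set)"
    by (simp add: corresponding_sequents_def)
  note empty = Lplus_iff[of "{}", unfolded no_sequents image_empty]
    L_iff[of "{}", unfolded no_sequents image_empty]
  show ?thesis
    by (simp only: CT_omega_from_def CT_omega_def mem_Collect_eq RRA_iff Lplus_iff L_iff true_iff empty
        no_sequents simp_thms)
qed

end
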